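(* For every constant $c\in(0,1/2)$ and every $\lambda_1,\lambda_2,\lambda_3,\lambda_4\ge0$ with $\sum_{i=1}^4\lambda_i=1$, there exists a non-opposite cut whose cost in the resulting convex combination $I=\lambda_1I_1+\lambda_2I_2+\lambda_3I_3+\lambda_4I_4$ is at most $1.20067+O(1/n)$.
   Context: Let $\Delta_{k,n}=\{x\in[0,1]^k:\sum_ix_i=1,\ nx\in\mathbb{Z}^k\}$, $e^i$ the $i$-th unit vector, $\mathrm{Support}(x)=\{i:x_i\neq0\}$. Let $G$ be the graph with node set $\Delta_{4,n}$ and edge set $E_{4,n}=\{xy:\|x-y\|_1=2/n\}$. A cut is $P:\Delta_{4,n}\to[5]$ with $P(e^i)=i$ ($i\in[4]$); it is non-opposite if $P(x)\in\mathrm{Support}(x)\cup\{5\}$ for all $x$. The cost of $P$ in an edge weighting is the total weight of edges $xy$ with $P(x)\neq P(y)$. For distinct $i,j$, $V_{ij}=\{x:\mathrm{Support}(x)\subseteq\{i,j\}\}$ and $L_{ij}$ is the set of edges with both endpoints in $V_{ij}$. Identify $\Delta_{3,n}$ with the face $\{x\in\Delta_{4,n}:x_4=0\}$. Here $n$ ranges over integers divisible by 3 with $cn$ an integer. Instance $J$ on $\Delta_{3,n}$: let $\rho=3/(5n)$ and $T_i=\{x\in\Delta_{3,n}:x_i>2/3\}$. For distinct $i,j\in[3]$ and $t\in\{1,\dots,n/3\}$, the edge of $L_{ij}$ whose endpoints have $i$-th coordinates $1-(t-1)/n$ and $1-t/n$ has cost $(n/3-t+1)\rho$ (symmetrically for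 $j$); every edge $xy\notin L_{12}\cup L_{13}\cup L_{23}$ with $x,y\in T_i$ for some $i$ and $x_i=y_i$ has cost $0$; every other face edge has cost $\rho$. For $\{i,j,k\}=[3]$: $U_k=\{x:x_4=0,x_k=1-c\}$, $R_k=U_k\cup\{x\in V_{ik}\cup V_{jk}:x_k\ge1-c\}$, $\Gamma_k=\{xy\in E_{4,n}:x,y\in R_k\}$. $I_1$: face edges get their $J$-cost, others $0$. $I_2$: weight $1/3$ on $L_{12}\cup L_{13}\cup L_{23}$, $0$ otherwise. $I_3$: weight $1/(9c)$ on $\Gamma_1\cup\Gamma_2\cup\Gamma_3$, $0$ otherwise. $I_4$: weight $1/n^2$ on every edge. *)

theory Defs
  imports Complex_Main "HOL-Library.Landau_Symbols"
begin

text \<open>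
  Points are functions on \<^typ>\<open>nat\<close> with coordinates \<open>1, \<dots>, k\<close> that vanish outside this range, so
  that the identification of the 3-dimensional grid with a face of the 4-dimensional one is literal
  (lemma \<open>grid_3_eq_face\<close>).
\<close>

type_synonym point = "nat \<Rightarrow> real"

definition grid :: "nat \<Rightarrow> nat \<Rightarrow> point set" where
  "grid k n = {x. (\<forall>i\<in>{1..k}. 0 \<le> x i \<and> x i \<le> 1 \<and> real n * x i \<in> \<int>)
                \<and> (\<forall>i. i \<notin> {1..k} \<longrightarrow> x i = 0) \<and> (\<Sum>i=1..k. x i) = 1}"

definition unit_vec :: "nat \<Rightarrow> point" where
  "unit_vec i = (\<lambda>j. if j = i then 1 else 0)"

definition Support :: "point \<Rightarrow> nat set" where
  "Support x = {i. x i \<noteq> 0}"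

lemma grid_3_eq_face: "grid 3 n = {x \<in> grid 4 n. x 4 = 0}"
proof -
  have s: "{1..4::nat} = insert 4 {1..3}" by auto
  show ?thesis unfolding grid_def s by force
qed

lemma finite_grid:
  assumes "n > 0"
  shows "finite (grid k n)"
proof -
  let ?B = "(\<lambda>m. real_of_int m / real n) ` {0..int n}"
  have "grid k n \<subseteq> {x. \<forall>i. (i \<in> {1..k} \<longrightarrow> x i \<in> ?B) \<and> (i \<notin> {1..k} \<longrightarrow> x i = 0)}"
  proof (intro subsetI CollectI allI conjI impI)
    fix x i assume x: "x \<in> grid k n" and i: "i \<in> {1..k}"
    then have r: "0 \<le> x i" "x i \<le> 1" "real n * x i \<in> \<int>" unfolding grid_def by auto
    from r(3) obtain m where m: "real n * x i = of_int m" by (auto elim: Ints_cases)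
    have "0 \<le> real n * x i" "real n * x i \<le> real n"
      using r(1,2) by (auto intro: mult_left_le)
    then have "m \<in> {0..int n}" unfolding m by auto
    moreover have "x i = of_int m / real n" using m assms by (simp add: field_simps)
    ultimately show "x i \<in> ?B" by blast
  qed (auto simp: grid_def)
  then show ?thesis
    by (rule finite_subset) (intro finite_set_of_finite_funs, auto)
qed

text \<open>Undirected edges are two-element sets; an edge weighting is a function on such sets.\<close>

definition edges :: "nat \<Rightarrow> nat \<Rightarrow> point set set" where
  "edges k n = {{x, y} | x y. x \<in> grid k n \<and> y \<in> grid k n
                  \<and> (\<Sum>i=1..k. \<bar>x i - y i\<bar>) = 2 / real n}"

lemma finite_edges:
  assumes "n > 0"
  shows "finite (edges k n)"
proof (rule finite_subset)
  show "edges k n \<subseteq> Pow (grid k n)" by (auto simp: edges_def)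
  show "finite (Pow (grid k n))" using finite_grid[OF assms] by simp
qed

definition is_cut :: "nat \<Rightarrow> (point \<Rightarrow> nat) \<Rightarrow> bool" where
  "is_cut n P \<longleftrightarrow> (\<forall>x\<in>grid 4 n. P x \<in> {1..5}) \<and> (\<forall>i\<in>{1..4}. P (unit_vec i) = i)"

definition non_opposite :: "nat \<Rightarrow> (point \<Rightarrow> nat) \<Rightarrow> bool" where
  "non_opposite n P \<longleftrightarrow> (\<forall>x\<in>grid 4 n. P x \<in> Support x \<union> {5})"

definition cut_cost :: "nat \<Rightarrow> (point set \<Rightarrow> real) \<Rightarrow> (point \<Rightarrow> nat) \<Rightarrow> real" where
  "cut_cost n w P = (\<Sum>e | e \<in> edges 4 n \<and> (\<exists>x\<in>e. \<exists>y\<in>e. P x \<noteq> P y). w e)"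

definition V :: "nat \<Rightarrow> nat \<Rightarrow> nat \<Rightarrow> point set" where
  "V n i j = {x \<in> grid 4 n. Support x \<subseteq> {i, j}}"

definition L :: "nat \<Rightarrow> nat \<Rightarrow> nat \<Rightarrow> point set set" where
  "L n i j = {e \<in> edges 4 n. e \<subseteq> V n i j}"

definition \<rho> :: "nat \<Rightarrow> real" where
  "\<rho> n = 3 / (5 * real n)"

definition T :: "nat \<Rightarrow> nat \<Rightarrow> point set" where
  "T n i = {x \<in> grid 3 n. x i > 2/3}"

definition side_edge :: "nat \<Rightarrow> nat \<Rightarrow> point set \<Rightarrow> bool" where
  "side_edge n t e \<longleftrightarrow> t \<in> {1..n div 3} \<and>
     (\<exists>i\<in>{1..3}. \<exists>j\<in>{1..3}. i \<noteq> j \<and> e \<in> L n i j \<and>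
       (\<exists>x y. e = {x, y} \<and> x i = 1 - (real t - 1) / real n \<and> y i = 1 - real t / real n))"

text \<open>The index \<open>t\<close> of a side edge is unique (lemma \<open>side_edge_unique\<close>), so the definite description
  below is well defined.\<close>

definition J :: "nat \<Rightarrow> point set \<Rightarrow> real" where
  "J n e =
     (if \<exists>t. side_edge n t e then (real n / 3 - real (THE t. side_edge n t e) + 1) * \<rho> n
      else if e \<notin> L n 1 2 \<union> L n 1 3 \<union> L n 2 3 \<and>
              (\<exists>i\<in>{1..3}. \<exists>x y. e = {x, y} \<and> x \<in> T n i \<and> y \<in> T n i \<and> x i = y i) then 0
      else \<rho> n)"

definition I1 :: "nat \<Rightarrow> point set \<Rightarrow> real" where
  "I1 n e = (if e \<in> edges 3 n then J n e else 0)"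

definition I2 :: "nat \<Rightarrow> point set \<Rightarrow> real" where
  "I2 n e = (if e \<in> L n 1 2 \<union> L n 1 3 \<union> L n 2 3 then 1/3 else 0)"

definition U :: "nat \<Rightarrow> real \<Rightarrow> nat \<Rightarrow> point set" where
  "U n c k = {x \<in> grid 4 n. x 4 = 0 \<and> x k = 1 - c}"

definition R :: "nat \<Rightarrow> real \<Rightarrow> nat \<Rightarrow> point set" where
  "R n c k = U n c k \<union> {x \<in> (\<Union>i\<in>{1..3} - {k}. V n i k). x k \<ge> 1 - c}"

definition \<Gamma> :: "nat \<Rightarrow> real \<Rightarrow> nat \<Rightarrow> point set set" where
  "\<Gamma> n c k = {e \<in> edges 4 n. e \<subseteq> R n c k}"

definition I3 :: "nat \<Rightarrow> real \<Rightarrow> point set \<Rightarrow> real" where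
  "I3 n c e = (if e \<in> \<Gamma> n c 1 \<union> \<Gamma> n c 2 \<union> \<Gamma> n c 3 then 1 / (9 * c) else 0)"

definition I4 :: "nat \<Rightarrow> point set \<Rightarrow> real" where
  "I4 n e = (if e \<in> edges 4 n then 1 / (real n)^2 else 0)"

lemma edges_3_eq_face_edges: "edges 3 n = {e \<in> edges 4 n. e \<subseteq> grid 3 n}"
proof -
  have s: "(\<Sum>i=1..4. \<bar>x i - y i\<bar>) = (\<Sum>i=1..3. \<bar>x i - y i\<bar>)"
    if "x \<in> grid 3 n" "y \<in> grid 3 n" for x y
  proof -
    have "{1..4::nat} = insert 4 {1..3}" by auto
    moreover have "x 4 = 0" "y 4 = 0" using that by (auto simp: grid_def)
    ultimately show ?thesis by simp
  qed
  have g: "grid 3 n \<subseteq> grid 4 n" by (auto simp: grid_3_eq_face)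
  show ?thesis
  proof (intro equalityI subsetI)
    fix e assume "e \<in> edges 3 n"
    then obtain x y where "e = {x, y}" "x \<in> grid 3 n" "y \<in> grid 3 n"
      "(\<Sum>i=1..3. \<bar>x i - y i\<bar>) = 2 / real n" unfolding edges_def by blast
    then show "e \<in> {e \<in> edges 4 n. e \<subseteq> grid 3 n}"
      using s[of x y] g unfolding edges_def by (auto simp del: sum.cl_ivl_Suc)
  next
    fix e assume "e \<in> {e \<in> edges 4 n. e \<subseteq> grid 3 n}"
    then obtain x y where "e = {x, y}" "x \<in> grid 3 n" "y \<in> grid 3 n"
      "(\<Sum>i=1..4. \<bar>x i - y i\<bar>) = 2 / real n" unfolding edges_def by blast
    then show "e \<in> edges 3 n"
      using s[of x y] unfolding edges_def by (auto simp del: sum.cl_ivl_Suc)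
  qed
qed

lemma V_coord_sum:
  assumes "x \<in> V n i j" "i \<in> {1..3}" "j \<in> {1..3}" "i \<noteq> j"
  shows "x i + x j = 1"
proof -
  have "(\<Sum>l=1..4. x l) = (\<Sum>l\<in>{i, j}. x l)"
    using assms by (intro sum.mono_neutral_right) (auto simp: V_def Support_def)
  then show ?thesis using assms by (simp add: V_def grid_def)
qed

lemma side_edge_unique:
  assumes "side_edge n s e" "side_edge n t e"
  shows "s = t"
proof -
  obtain i j x y where 1: "s \<in> {1..n div 3}" "i \<in> {1..3}" "j \<in> {1..3}" "i \<noteq> j" "e \<in> L n i j"
    "e = {x, y}" "x i = 1 - (real s - 1) / real n" "y i = 1 - real s / real n"
    using assms(1) unfolding side_edge_def by blast
  obtain k l u v where 2: "t \<in> {1..n div 3}" "k \<in> {1..3}" "l \<in> {1..3}" "k \<noteq> l" "e \<in> L n k l"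
    "e = {u, v}" "u k = 1 - (real t - 1) / real n" "v k = 1 - real t / real n"
    using assms(2) unfolding side_edge_def by blast
  have n: "n > 0" using 1(1) by (cases n) auto
  have b: "3 * real s \<le> real n" "3 * real t \<le> real n" using 1(1) 2(1) by auto
  have d: "1 - (real m - 1) / real n = (real n - real m + 1) / real n"
    "1 - real m / real n = (real n - real m) / real n" for m
    using n by (simp_all add: field_simps)
  have e: "x i > 1/2" "y i > 1/2" "u k > 1/2" "v k > 1/2"
    using 1(7,8) 2(7,8) b n unfolding d by (simp_all add: less_divide_eq)
  have "x \<in> V n i j" using 1(5,6) by (simp add: L_def)
  then have s1: "x i + x j = 1" using 1(2-4) by (rule V_coord_sum)
  have z: "x m = 0" if "m \<notin> {i, j}" for m
    using that 1 by (auto simp: L_def V_def Support_def)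
  have "x k > 1/2" using e 2(6) 1(6) by (auto simp: doubleton_eq_iff)
  then have "k = i" using s1 e(1) z[of k] by force
  then have "{x i, y i} = {u i, v i}" using 1(6) 2(6) by (auto simp: doubleton_eq_iff)
  then have "x i + y i = u i + v i" using 1(6) 2(6) by (auto simp: doubleton_eq_iff)
  then have "(2 * real n - 2 * real s + 1) / real n = (2 * real n - 2 * real t + 1) / real n"
    using 1(7,8) 2(7,8) \<open>k = i\<close> unfolding d by (simp add: add_divide_distrib[symmetric])
  then show ?thesis using n by simp
qed

end

theory Submission
  imports Defs
begin

text \<open>
  Three families of cuts suffice. Every cut used here sends the open part \<open>0 < x\<^sub>4 < 1\<close> to \<open>5\<close>.
  Up to \<open>O(1/n)\<close> the costs in \<open>I\<^sub>1, I\<^sub>2, I\<^sub>3, I\<^sub>4\<close> are: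
  \<^item> \<open>Y\<close>, labelling the face \<open>x\<^sub>4 = 0\<close> by the largest coordinate: \<open>6/5, 1, 0, 3/2\<close>;
  \<^item> \<open>A\<^sub>0\<close>, giving only the vertices a label other than \<open>5\<close>: \<open>6/5, 2, 2/(3c), 0\<close>;
  \<^item> \<open>A\<^sub>c\<close> for \<open>c < 1/9\<close>, labelling the face corners \<open>x\<^sub>k \<ge> 1 - c\<close> by \<open>k\<close>: \<open>6/5, 2, 0, 9c\<^sup>2/2\<close>.

  If \<open>c \<ge> 1/9\<close>, the average with weights \<open>4/5\<close> on \<open>Y\<close> and \<open>1/5\<close> on \<open>A\<^sub>0\<close> costs at most \<open>6/5\<close> in every
  \<open>I\<^sub>j\<close>. If \<open>c < 1/9\<close>, put \<open>0.79933\<close> on \<open>Y\<close>, the weight \<open>1.801005 c\<close> on \<open>A\<^sub>0\<close> that makes the average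
  cost in \<open>I\<^sub>3\<close> equal to \<open>1.20067\<close>, and the rest on \<open>A\<^sub>c\<close>; the cost in \<open>I\<^sub>4\<close> is then a cubic in \<open>c\<close> with
  maximum below \<open>1.20067\<close>. By linearity, for given weights \<open>\<lambda>\<^sub>j\<close> one of the cuts is at least as good
  as the average.
\<close>

section \<open>Scaled grid points and the parametrisation of edges\<close>

text \<open>Grid points are handled through their coordinates scaled by \<open>n\<close>; the edges are the pairs
  obtained from a vector with coordinate sum \<open>n - 1\<close> by incrementing one of two coordinates.\<close>

definition lattice :: "nat \<Rightarrow> (nat \<Rightarrow> nat) set" where
  "lattice N = {a. (\<forall>i. i \<notin> {1..4} \<longrightarrow> a i = 0) \<and> a 1 + a 2 + a 3 + a 4 = N}"

definition pt :: "nat \<Rightarrow> (nat \<Rightarrow> nat) \<Rightarrow> point" where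
  "pt n a = (\<lambda>i. real (a i) / real n)"

definition coords :: "nat \<Rightarrow> point \<Rightarrow> nat \<Rightarrow> nat" where
  "coords n x = (\<lambda>i. nat \<lfloor>real n * x i\<rfloor>)"

definition inc :: "(nat \<Rightarrow> nat) \<Rightarrow> nat \<Rightarrow> nat \<Rightarrow> nat" where
  "inc m i = m(i := m i + 1)"

definition edge :: "nat \<Rightarrow> (nat \<Rightarrow> nat) \<Rightarrow> nat \<Rightarrow> nat \<Rightarrow> point set" where
  "edge n m i j = {pt n (inc m i), pt n (inc m j)}"

lemma edge_commute: "edge n m i j = edge n m j i"
  by (auto simp: edge_def)

lemma atLeastAtMost_1_3: "{1..3::nat} = {1, 2, 3}" and atLeastAtMost_1_4: "{1..4::nat} = {1, 2, 3, 4}"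
  by auto

lemma coords_pt: "n > 0 \<Longrightarrow> coords n (pt n a) = a"
  by (auto simp: coords_def pt_def)

lemma lattice_eqI:
  assumes "a \<in> lattice N" "b \<in> lattice N'" "a 1 = b 1" "a 2 = b 2" "a 3 = b 3" "a 4 = b 4"
  shows "a = b"
proof
  fix i
  show "a i = b i"
  proof (cases "i \<in> {1..4}")
    case True
    then show ?thesis using assms(3-6) unfolding atLeastAtMost_1_4 by auto
  next
    case False
    then show ?thesis using assms(1,2) by (simp add: lattice_def)
  qed
qed

lemma inc_lattice:
  assumes "m \<in> lattice (n - 1)" "n > 0" "i \<in> {1..4}"
  shows "inc m i \<in> lattice n"
  using assms unfolding lattice_def inc_def atLeastAtMost_1_4 by auto

text \<open>On grid points \<open>real n * x i\<close> is a nonnegative integer, so neither the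
  floor nor \<open>nat\<close> in \<open>coords\<close> loses anything. Together with
  \<open>coords_pt\<close> this lets labellings of scaled vectors stand for labellings of
  points.\<close>

lemma grid_coords:
  assumes "x \<in> grid 4 n" "n > 0"
  shows "pt n (coords n x) = x" "coords n x \<in> lattice n"
proof -
  have sup: "x i = 0" if "i \<notin> {1..4}" for i
    using assms(1) that by (simp add: grid_def)
  have nn: "real (coords n x i) = real n * x i" for i
  proof (cases "i \<in> {1..4}")
    case True
    then have "0 \<le> x i" "real n * x i \<in> \<int>" using assms(1) by (auto simp: grid_def)
    then show ?thesis by (auto simp: coords_def elim!: Ints_cases)
  next
    case False
    then show ?thesis by (simp add: sup coords_def)
  qed
  show "pt n (coords n x) = x" using assms(2) by (simp add: pt_def nn)
  have "real (coords n x 1 + coords n x 2 + coords n x 3 + coords n x 4)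
      = real n * (x 1 + x 2 + x 3 + x 4)"
    by (simp add: nn distrib_left)
  also have "x 1 + x 2 + x 3 + x 4 = 1"
    using assms(1) unfolding grid_def atLeastAtMost_1_4 by (simp add: add.assoc)
  finally have "coords n x 1 + coords n x 2 + coords n x 3 + coords n x 4 = n"
    by (simp only: mult_1_right of_nat_eq_iff)
  moreover have "coords n x i = 0" if "i \<notin> {1..4}" for i
    using sup[OF that] by (simp add: coords_def)
  ultimately show "coords n x \<in> lattice n" by (simp add: lattice_def)
qed

text \<open>The zero sum makes each entry minus the sum of the others, so 2 |\<open>d l\<close>| is
  at most 2. All entries then lie in {-1, 0, 1}, and a finite case check remains.\<close>

lemma int_unit_step:
  fixes d :: "nat \<Rightarrow> int"
  assumes "d 1 + d 2 + d 3 + d 4 = 0" "\<bar>d 1\<bar> + \<bar>d 2\<bar> + \<bar>d 3\<bar> + \<bar>d 4\<bar> = 2"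
  obtains i j where "i \<in> {1..4}" "j \<in> {1..4}" "i < j" "d i = 1 \<and> d j = -1 \<or> d i = -1 \<and> d j = 1"
    "\<forall>l\<in>{1..4} - {i, j}. d l = 0"
proof -
  have d: "d l \<in> {-1, 0, 1}" if "l \<in> {1, 2, 3, 4}" for l
  proof -
    have "\<bar>d l\<bar> \<le> 1" using that assms by auto
    then show ?thesis by auto
  qed
  have "d 1 \<in> {-1, 0, 1}" "d 2 \<in> {-1, 0, 1}" "d 3 \<in> {-1, 0, 1}" "d 4 \<in> {-1, 0, 1}"
    by (rule d; simp)+
  then have "\<exists>i\<in>{1,2,3,4}. \<exists>j\<in>{1,2,3,4}. i < j \<and> (d i = 1 \<and> d j = -1 \<or> d i = -1 \<and> d j = 1) \<and>
      (\<forall>l\<in>{1,2,3,4} - {i, j}. d l = 0)"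
    using assms by (elim insertE emptyE; simp add: insert_Diff_if)
  then show thesis using that unfolding atLeastAtMost_1_4 by blast
qed

text \<open>Scaling by \<open>n\<close> turns the distance 2/n into integer distance 2, so the
  endpoints differ by moving one unit between two coordinates. Removing that unit from either
  endpoint leaves the common base \<open>m\<close>.\<close>

lemma edges_cases:
  assumes "e \<in> edges 4 n" "n > 0"
  obtains m i j where "m \<in> lattice (n - 1)" "i \<in> {1..4}" "j \<in> {1..4}" "i < j" "e = edge n m i j"
proof -
  note result = that
  obtain x y where xy: "e = {x, y}" "x \<in> grid 4 n" "y \<in> grid 4 n"
    and d: "(\<Sum>i=1..4. \<bar>x i - y i\<bar>) = 2 / real n"
    using assms(1) unfolding edges_def by blast
  define a b where "a = coords n x" and "b = coords n y"
  have ab: "a \<in> lattice n" "b \<in> lattice n" "x = pt n a" "y = pt n b"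
    using grid_coords[OF xy(2) assms(2)] grid_coords[OF xy(3) assms(2)] by (auto simp: a_def b_def)
  have "\<bar>x i - y i\<bar> = real_of_int \<bar>int (a i) - int (b i)\<bar> / real n" for i
    using assms(2) by (simp add: ab pt_def flip: diff_divide_distrib)
  then have "real_of_int (\<Sum>i=1..4. \<bar>int (a i) - int (b i)\<bar>) / real n = 2 / real n"
    using d by (simp add: sum_divide_distrib del: sum.cl_ivl_Suc)
  then have "real_of_int (\<Sum>i=1..4. \<bar>int (a i) - int (b i)\<bar>) = 2"
    using assms(2) by (simp del: sum.cl_ivl_Suc of_int_sum)
  then have "(\<Sum>i=1..4. \<bar>int (a i) - int (b i)\<bar>) = 2" by linarith
  then have s2: "\<bar>int (a 1) - int (b 1)\<bar> + \<bar>int (a 2) - int (b 2)\<bar> + \<bar>int (a 3) - int (b 3)\<bar>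
      + \<bar>int (a 4) - int (b 4)\<bar> = 2"
    unfolding atLeastAtMost_1_4 by (simp add: add.assoc)
  have s0: "(int (a 1) - int (b 1)) + (int (a 2) - int (b 2)) + (int (a 3) - int (b 3))
      + (int (a 4) - int (b 4)) = 0"
    using ab(1,2) by (simp add: lattice_def)
  \<comment> \<open>Stated for either order of the endpoints: \<open>i < j\<close> is fixed, so the
    endpoint that is larger at \<open>i\<close> may be \<open>a\<close> or \<open>b\<close>.\<close>
  have step: thesis if u: "u \<in> lattice n" and v: "v \<in> lattice n" and e: "e = {pt n u, pt n v}"
    and ij: "i \<in> {1..4}" "j \<in> {1..4}" "i < j" "u i = v i + 1" "v j = u j + 1"
    and o: "\<And>l. l \<in> {1..4} \<Longrightarrow> l \<noteq> i \<Longrightarrow> l \<noteq> j \<Longrightarrow> u l = v l" for u v i j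
  proof (rule result)
    let ?m = "u(i := v i)"
    have m: "inc ?m i = u" using ij by (auto simp: inc_def)
    have "inc ?m j l = v l" for l
    proof (cases "l \<in> {1..4}")
      case True
      then show ?thesis using ij o[of l] by (auto simp: inc_def)
    next
      case False
      then show ?thesis using u v ij by (auto simp: inc_def lattice_def)
    qed
    then have m': "inc ?m j = v" by auto
    show "e = edge n ?m i j" using e m m' by (simp add: edge_def)
    show "?m \<in> lattice (n - 1)" using u ij unfolding lattice_def atLeastAtMost_1_4 by auto
  qed (use ij in auto)
  have e: "e = {pt n a, pt n b}" "e = {pt n b, pt n a}" using xy(1) ab by auto
  note st = step[OF ab(1,2) e(1)] step[OF ab(2,1) e(2)]
  obtain i j where ij: "i \<in> {1..4}" "j \<in> {1..4}" "i < j"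
    and dij: "int (a i) - int (b i) = 1 \<and> int (a j) - int (b j) = -1
      \<or> int (a i) - int (b i) = -1 \<and> int (a j) - int (b j) = 1"
    and o: "\<forall>l\<in>{1..4} - {i, j}. int (a l) - int (b l) = 0"
    using int_unit_step[of "\<lambda>i. int (a i) - int (b i)", OF s0 s2] by blast
  from o have o': "a l = b l" if "l \<in> {1..4}" "l \<noteq> i" "l \<noteq> j" for l
    using that by simp
  from dij show thesis
  proof
    assume "int (a i) - int (b i) = 1 \<and> int (a j) - int (b j) = -1"
    then show thesis using step[OF ab(1,2) e(1) ij] o' by auto
  next
    assume "int (a i) - int (b i) = -1 \<and> int (a j) - int (b j) = 1"
    then show thesis using step[OF ab(2,1) e(2) ij] o' by auto
  qed
qed

section \<open>Bounds on cut costs from families covering the cut edges\<close>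

text \<open>Since weights are nonnegative, \<open>E\<close> may repeat edges and may list edges that
  are not cut; only cut edges of nonzero weight must be listed. Each cost estimate thus becomes a
  count over a convenient index set.\<close>

lemma cut_cost_le_cover:
  fixes w :: "point set \<Rightarrow> real"
  assumes n: "n > 0" and w: "\<And>e. 0 \<le> w e" and X: "finite X"
    and cov: "\<And>m i j. \<lbrakk>m \<in> lattice (n - 1); i \<in> {1..4}; j \<in> {1..4}; i < j; F (inc m i) \<noteq> F (inc m j);
      edge n m i j \<in> edges 4 n; w (edge n m i j) \<noteq> 0\<rbrakk> \<Longrightarrow> edge n m i j \<in> E ` X"
  shows "cut_cost n w (F \<circ> coords n) \<le> (\<Sum>t\<in>X. w (E t))"
proof -
  let ?C = "{e. e \<in> edges 4 n \<and> (\<exists>x\<in>e. \<exists>y\<in>e. (F \<circ> coords n) x \<noteq> (F \<circ> coords n) y)}"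
  have fin: "finite ?C" using finite_edges[OF n] by simp
  have "e \<in> E ` X" if "e \<in> ?C" "w e \<noteq> 0" for e
  proof -
    from that obtain m i j where m: "m \<in> lattice (n - 1)" "i \<in> {1..4}" "j \<in> {1..4}" "i < j"
      "e = edge n m i j" using edges_cases[of e n] n by blast
    moreover have "F (inc m i) \<noteq> F (inc m j)"
      using that(1) coords_pt[OF n] unfolding m(5) edge_def by auto
    ultimately show ?thesis using that cov by auto
  qed
  then have sub: "{e\<in>?C. w e \<noteq> 0} \<subseteq> E ` X" by blast
  have "cut_cost n w (F \<circ> coords n) = sum w {e\<in>?C. w e \<noteq> 0}"
    unfolding cut_cost_def using fin by (intro sum.mono_neutral_right) auto
  also have "\<dots> \<le> sum w (E ` X)"
    using sub X w by (intro sum_mono2) auto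
  also have "\<dots> \<le> (\<Sum>t\<in>X. w (E t))"
    using sum_image_le[OF X, of w E] w by (simp add: o_def)
  finally show ?thesis .
qed

text \<open>The conditions under which a labelling of scaled points is a non-opposite cut that only
  meets edges on the face or leaving it upwards, apart from the three edges at \<open>e\<^sup>4\<close>.\<close>

definition face_labelling :: "nat \<Rightarrow> ((nat \<Rightarrow> nat) \<Rightarrow> nat) \<Rightarrow> bool" where
  "face_labelling n F \<longleftrightarrow> (\<forall>a\<in>lattice n.
     (a 4 = n \<longrightarrow> F a = 4) \<and> (0 < a 4 \<and> a 4 < n \<longrightarrow> F a = 5) \<and>
     (a 4 = 0 \<longrightarrow> F a = 5 \<or> F a \<in> {1..3} \<and> a (F a) \<noteq> 0) \<and> (\<forall>k\<in>{1..3}. a k = n \<longrightarrow> F a = k))"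

lemma face_labelling_cut:
  assumes n: "n > 0" and F: "face_labelling n F"
  shows "is_cut n (F \<circ> coords n)" "non_opposite n (F \<circ> coords n)"
proof -
  have lab: "F (coords n x) \<in> {1..5}" "F (coords n x) \<in> Support x \<union> {5}" if x: "x \<in> grid 4 n" for x
  proof -
    let ?a = "coords n x"
    have a: "?a \<in> lattice n" "pt n ?a = x" using grid_coords[OF x n] by auto
    have 5: "F ?a \<in> {1..5} \<and> (F ?a = 5 \<or> ?a (F ?a) \<noteq> 0)"
    proof -
      consider "?a 4 = n" | "0 < ?a 4" "?a 4 < n" | "?a 4 = 0" using a(1) by (fastforce simp: lattice_def)
      then show ?thesis using F a(1) n unfolding face_labelling_def by cases fastforce+
    qed
    show "F ?a \<in> {1..5}" using 5 by simp
    have "x l \<noteq> 0" if "?a l \<noteq> 0" for l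
      using that n by (subst a(2)[symmetric]) (simp add: pt_def)
    then show "F ?a \<in> Support x \<union> {5}" using 5 by (auto simp: Support_def)
  qed
  have "F (coords n (unit_vec i)) = i" if i: "i \<in> {1..4}" for i
  proof -
    let ?a = "coords n (unit_vec i)"
    have e: "?a = (\<lambda>j. if j = i then n else 0)" by (auto simp: coords_def unit_vec_def)
    then have "?a \<in> lattice n" using i unfolding lattice_def atLeastAtMost_1_4 by auto
    moreover have "?a i = n" using e by simp
    moreover have "i = 4 \<or> i \<in> {1..3}" using i by auto
    ultimately show ?thesis using F unfolding face_labelling_def by blast
  qed
  then show "is_cut n (F \<circ> coords n)" "non_opposite n (F \<circ> coords n)"
    using lab by (auto simp: is_cut_def non_opposite_def)
qed

lemma lattice_4_eq:
  assumes "m \<in> lattice N" "m 4 = N"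
  shows "m = (\<lambda>l. if l = 4 then N else 0)"
proof -
  have "(\<lambda>l. if l = 4 then N else 0) \<in> lattice N" by (simp add: lattice_def)
  then show ?thesis using assms by (intro lattice_eqI[OF assms(1)]) (auto simp: lattice_def)
qed

text \<open>Edges with both ends strictly between the face and the top vertex join points labelled
  5. What remains are face edges (\<open>A\<close>), edges from the face to height 1/n
  (\<open>B\<close>), and the three edges at the top vertex (\<open>g\<close>). As
  \<open>n \<ge> 2\<close>, height 1/n is below the top and labelled 5, so an edge of the second
  kind is cut only if its face end is not labelled 5.\<close>

lemma I4_cost_le:
  assumes n: "n \<ge> 2" and F: "face_labelling n F" and A: "finite A" and B: "finite B"
    and covA: "\<And>m i j. \<lbrakk>m \<in> lattice (n - 1); m 4 = 0; i \<in> {1..3}; j \<in> {1..3}; i < j;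
      F (inc m i) \<noteq> F (inc m j)\<rbrakk> \<Longrightarrow> edge n m i j \<in> (\<lambda>(m, i, j). edge n m i j) ` A"
    and covB: "\<And>m i. \<lbrakk>m \<in> lattice (n - 1); m 4 = 0; i \<in> {1..3}; F (inc m i) \<noteq> 5\<rbrakk> \<Longrightarrow> (m, i) \<in> B"
  shows "cut_cost n (I4 n) (F \<circ> coords n) \<le> (real (card A) + real (card B) + 3) / (real n)\<^sup>2"
proof -
  define f where "f = (\<lambda>(m :: nat \<Rightarrow> nat, i :: nat). (m, i, 4 :: nat))"
  define g where "g = (\<lambda>i :: nat. ((\<lambda>l :: nat. if l = 4 then n - 1 else 0), i, 4 :: nat))"
  define X where "X = A \<union> f ` B \<union> g ` {1..3}"
  have X: "finite X" using A B by (simp add: X_def)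
  have "card X \<le> card A + card (f ` B) + card (g ` {1..3})"
    unfolding X_def using card_Un_le[of "A \<union> f ` B" "g ` {1..3}"] card_Un_le[of A "f ` B"] by linarith
  also have "\<dots> \<le> card A + card B + 3"
    using card_image_le[OF B, of f] card_image_le[of "{1..3}" g] by simp
  finally have card: "real (card X) \<le> real (card A) + real (card B) + 3" by linarith
  have "cut_cost n (I4 n) (F \<circ> coords n) \<le> (\<Sum>t\<in>X. I4 n ((\<lambda>(m, i, j). edge n m i j) t))"
  proof (rule cut_cost_le_cover)
    fix m i j
    assume m: "m \<in> lattice (n - 1)" and i: "i \<in> {1..4}" and j: "j \<in> {1..4}" and ij: "i < j"
      and neq: "F (inc m i) \<noteq> F (inc m j)"
    have li: "inc m i \<in> lattice n" and lj: "inc m j \<in> lattice n"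
      using inc_lattice[OF m] n i j by auto
    have le: "m 4 \<le> n - 1" using m by (auto simp: lattice_def)
    have i3: "i \<in> {1..3}" using i j ij by auto
    then have i4: "inc m i 4 = m 4" by (auto simp: inc_def)
    have five: "F a = 5" if "a \<in> lattice n" "0 < a 4" "a 4 < n" for a
      using F that by (simp add: face_labelling_def)
    consider (face) "j \<in> {1..3}" "m 4 = 0" | (inner) "j \<in> {1..3}" "m 4 > 0"
      | (up) "j = 4" "m 4 = 0" | (top) "j = 4" "m 4 > 0" using j by force
    then show "edge n m i j \<in> (\<lambda>(m, i, j). edge n m i j) ` X"
    proof cases
      case face
      then show ?thesis using covA[OF m _ i3 _ ij neq] by (auto simp: X_def)
    next
      case inner
      then have "inc m j 4 = m 4" by (auto simp: inc_def)
      then have "F (inc m i) = 5" "F (inc m j) = 5" using five li lj i4 inner le n by auto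
      then show ?thesis using neq by simp
    next
      case up
      then have "F (inc m j) = 5" using five[OF lj] n by (simp add: inc_def)
      then have "(m, i) \<in> B" using covB[OF m up(2) i3] neq by simp
      then have "(m, i, 4) \<in> X" by (force simp: X_def f_def)
      then show ?thesis using up by force
    next
      case top
      then have "F (inc m i) = 5" using five[OF li] i4 le n by simp
      then have "\<not> inc m j 4 < n" using five[OF lj] neq top by (auto simp: inc_def)
      then have "m 4 = n - 1" using top le by (simp add: inc_def)
      then have "(m, i, 4) \<in> X" using i3 lattice_4_eq[OF m] by (auto simp: X_def g_def)
      then show ?thesis using top by force
    qed
  qed (use X n in \<open>auto simp: I4_def\<close>)
  also have "\<dots> \<le> (\<Sum>t\<in>X. 1 / (real n)\<^sup>2)"
    by (intro sum_mono) (auto simp: I4_def)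
  also have "\<dots> \<le> (real (card A) + real (card B) + 3) / (real n)\<^sup>2"
    using card by (simp add: divide_right_mono)
  finally show ?thesis .
qed

lemma pt_coord_eq_0: "n > 0 \<Longrightarrow> pt n a i = 0 \<longleftrightarrow> a i = 0"
  by (simp add: pt_def)

lemma edge_face:
  assumes "edge n m i j \<in> edges 3 n" "n > 0"
  shows "m 4 = 0" "i \<noteq> 4" "j \<noteq> 4"
proof -
  have "pt n (inc m i) 4 = 0" "pt n (inc m j) 4 = 0"
    using assms(1) by (auto simp: edges_3_eq_face_edges edge_def grid_3_eq_face)
  then have "inc m i 4 = 0" "inc m j 4 = 0" using assms(2) by (auto simp: pt_coord_eq_0)
  then show "m 4 = 0" "i \<noteq> 4" "j \<noteq> 4" by (auto simp: inc_def split: if_splits)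
qed

lemma edge_side:
  assumes "edge n m i j \<in> L n p q" "n > 0" "l \<notin> {p, q}"
  shows "m l = 0" "i \<noteq> l" "j \<noteq> l"
proof -
  have "pt n (inc m i) l = 0" "pt n (inc m j) l = 0"
    using assms by (auto simp: L_def edge_def V_def Support_def)
  then have "inc m i l = 0" "inc m j l = 0" using assms(2) by (auto simp: pt_coord_eq_0)
  then show "m l = 0" "i \<noteq> l" "j \<noteq> l" by (auto simp: inc_def split: if_splits)
qed

lemma R_face:
  assumes "x \<in> R n c k" "k \<in> {1..3}"
  shows "x \<in> grid 4 n" "x 4 = 0" "x k \<ge> 1 - c"
  using assms unfolding R_def U_def V_def Support_def by auto

text \<open>By \<open>R_face\<close>, both ends of an edge in \<open>\<Gamma> n c k\<close> satisfy
  the premise of \<open>F\<close> and are labelled \<open>k\<close>, so the empty family covers all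
  cut edges of positive weight.\<close>

lemma I3_cost_eq_0:
  assumes n: "n > 0" and c: "c > 0"
    and F: "\<And>a k. \<lbrakk>a \<in> lattice n; a 4 = 0; k \<in> {1..3}; real (a k) \<ge> (1 - c) * real n\<rbrakk> \<Longrightarrow> F a = k"
  shows "cut_cost n (I3 n c) (F \<circ> coords n) \<le> 0"
proof -
  have "cut_cost n (I3 n c) (F \<circ> coords n) \<le> (\<Sum>t\<in>{}. I3 n c t)"
  proof (rule cut_cost_le_cover)
    fix m i j
    assume m: "m \<in> lattice (n - 1)" "i \<in> {1..4}" "j \<in> {1..4}"
      and neq: "F (inc m i) \<noteq> F (inc m j)" and "I3 n c (edge n m i j) \<noteq> 0"
    then have "\<exists>k\<in>{1, 2, 3}. edge n m i j \<in> \<Gamma> n c k"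
      by (auto simp: I3_def split: if_splits)
    then obtain k where k: "k \<in> {1..3}" "edge n m i j \<in> \<Gamma> n c k"
      unfolding atLeastAtMost_1_3 by blast
    have "F a = k" if "pt n a \<in> edge n m i j" "a \<in> lattice n" for a
    proof (rule F[OF that(2) _ k(1)])
      have R: "pt n a \<in> R n c k" using k(2) that(1) by (auto simp: \<Gamma>_def)
      then have "pt n a 4 = 0 \<and> pt n a k \<ge> 1 - c" using R_face k(1) by blast
      then show "a 4 = 0" "real (a k) \<ge> (1 - c) * real n"
        using n by (auto simp: pt_def field_simps)
    qed
    then have "F (inc m i) = k" "F (inc m j) = k" using inc_lattice[OF m(1) n] m(2,3)
      by (auto simp: edge_def)
    then show "edge n m i j \<in> (\<lambda>e. e) ` {}" using neq by simp
  qed (use n c in \<open>auto simp: I3_def\<close>)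
  then show ?thesis by simp
qed

section \<open>Edge costs of the instance on the face\<close>

lemma J_nonneg: "J n e \<ge> 0"
proof (cases "\<exists>t. side_edge n t e")
  case True
  then obtain t where t: "side_edge n t e" by blast
  then have "(THE t. side_edge n t e) = t" using side_edge_unique by blast
  moreover have "real t \<le> real n / 3"
  proof -
    have "3 * t \<le> n" using t by (auto simp: side_edge_def)
    then show ?thesis by linarith
  qed
  ultimately show ?thesis using True by (simp add: J_def \<rho>_def)
qed (auto simp: J_def \<rho>_def)

lemma J_side_edge: "side_edge n t e \<Longrightarrow> J n e = (real n / 3 - real t + 1) * \<rho> n"
proof -
  assume t: "side_edge n t e"
  then have "(THE t. side_edge n t e) = t" using side_edge_unique by blast
  then show ?thesis using t by (auto simp: J_def)
qed

lemma J_le_rho: "(\<And>t. \<not> side_edge n t e) \<Longrightarrow> J n e \<le> \<rho> n"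
  by (auto simp: J_def \<rho>_def)

section \<open>Corner cuts and their four costs\<close>

text \<open>\<open>M\<close> is the corner size in units of 1/n: \<open>M = 0\<close> gives the cut
  \<open>A\<^sub>0\<close>, and \<open>M = c n\<close> gives \<open>A\<^sub>c\<close>.\<close>

definition corner_cut :: "nat \<Rightarrow> nat \<Rightarrow> (nat \<Rightarrow> nat) \<Rightarrow> nat" where
  "corner_cut n M a = (if a 4 = n then 4 else if a 4 \<noteq> 0 then 5 else if n \<le> a 1 + M then 1
     else if n \<le> a 2 + M then 2 else if n \<le> a 3 + M then 3 else 5)"

text \<open>Since \<open>2 * M < n\<close>, two corners cannot meet: two such coordinates would add
  up to more than \<open>n\<close>. The order of the tests is therefore immaterial.\<close>

lemma corner_cut_eq:
  assumes "a \<in> lattice n" "a 4 = 0" "2 * M < n" "k \<in> {1..3}" "n \<le> a k + M"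
  shows "corner_cut n M a = k"
  using assms unfolding corner_cut_def lattice_def atLeastAtMost_1_3 by auto

lemma face_labelling_corner_cut:
  assumes "2 * M < n"
  shows "face_labelling n (corner_cut n M)"
  using assms unfolding face_labelling_def atLeastAtMost_1_3 corner_cut_def lattice_def by auto

text \<open>A triple \<open>(k, l, r)\<close> stands for the edge leaving the corner of \<open>k\<close> in direction \<open>l\<close> whose third
  coordinate \<open>6 - k - l\<close> is \<open>r/n\<close>; the edges on the sides are those with \<open>r = 0\<close>.\<close>

definition corner_index :: "nat \<Rightarrow> (nat \<times> nat \<times> nat) set" where
  "corner_index M = {(k, l, r). k \<in> {1..3} \<and> l \<in> {1..3} \<and> k \<noteq> l \<and> r \<le> M}"

text \<open>Incrementing \<open>k\<close> reaches \<open>n - M\<close>, the last row inside the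
  corner; incrementing \<open>l\<close> stays in the first row outside it.\<close>

definition corner_base :: "nat \<Rightarrow> nat \<Rightarrow> nat \<Rightarrow> nat \<Rightarrow> nat \<Rightarrow> nat \<Rightarrow> nat" where
  "corner_base n M k l r = (\<lambda>i. if i = k then n - M - 1 else if i = l then M - r
     else if i = 6 - k - l then r else 0)"

definition corner_edge :: "nat \<Rightarrow> nat \<Rightarrow> nat \<times> nat \<times> nat \<Rightarrow> point set" where
  "corner_edge n M = (\<lambda>(k, l, r). edge n (corner_base n M k l r) k l)"

lemma sum_corner_index:
  fixes f :: "nat \<times> nat \<times> nat \<Rightarrow> real"
  assumes "\<And>k l. k \<in> {1..3} \<Longrightarrow> l \<in> {1..3} \<Longrightarrow> k \<noteq> l \<Longrightarrow> (\<Sum>r\<le>M. f (k, l, r)) \<le> b"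
  shows "finite (corner_index M)" "(\<Sum>t\<in>corner_index M. f t) \<le> 6 * b"
proof -
  define Q :: "(nat \<times> nat) set" where "Q = {(1, 2), (1, 3), (2, 1), (2, 3), (3, 1), (3, 2)}"
  define P where "P = Q \<times> {..M}"
  define h :: "(nat \<times> nat) \<times> nat \<Rightarrow> nat \<times> nat \<times> nat" where "h = (\<lambda>((k, l), r). (k, l, r))"
  have im: "corner_index M = h ` P"
    unfolding corner_index_def h_def P_def Q_def atLeastAtMost_1_3 by (auto simp: image_iff)
  show "finite (corner_index M)" unfolding im P_def Q_def by simp
  have "inj_on h P" by (auto simp: inj_on_def h_def)
  then have "(\<Sum>t\<in>corner_index M. f t) = (\<Sum>t\<in>P. f (h t))" by (simp add: im sum.reindex)
  also have "\<dots> = (\<Sum>(k, l)\<in>Q. \<Sum>r\<le>M. f (k, l, r))"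
    unfolding P_def h_def by (simp add: sum.cartesian_product split_def)
  also have "\<dots> \<le> (\<Sum>(k, l)\<in>Q. b)"
    by (intro sum_mono) (auto simp: Q_def intro!: assms)
  finally show "(\<Sum>t\<in>corner_index M. f t) \<le> 6 * b" by (simp add: Q_def)
qed

lemma third_index:
  fixes k l :: nat and m :: "nat \<Rightarrow> nat"
  assumes "k \<in> {1..3}" "l \<in> {1..3}" "k \<noteq> l"
  shows "k \<noteq> 6 - k - l" "l \<noteq> 6 - k - l" "{k, l, 6 - k - l} = {1..3}"
    "m k + m l + m (6 - k - l) = m 1 + m 2 + m 3"
  using assms unfolding atLeastAtMost_1_3
  by (elim insertE emptyE; simp add: insert_commute)+

text \<open>The endpoints can fall on different sides of a threshold only if incrementing
  \<open>i\<close> or \<open>j\<close> reaches it exactly. That coordinate serves as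
  \<open>k\<close>; the other two coordinates of \<open>m\<close> then sum to \<open>M\<close>, so
  the third one is a valid \<open>r\<close>.\<close>

lemma corner_cover:
  assumes M: "2 * M < n" and m: "m \<in> lattice (n - 1)" "m 4 = 0"
    and ij: "i \<in> {1..3}" "j \<in> {1..3}" "i < j"
    and neq: "corner_cut n M (inc m i) \<noteq> corner_cut n M (inc m j)"
  shows "edge n m i j \<in> corner_edge n M ` corner_index M"
proof -
  have key: "edge n m k l \<in> corner_edge n M ` corner_index M"
    if kl: "k \<in> {1..3}" "l \<in> {1..3}" "k \<noteq> l" "m k + 1 + M = n" for k l
  proof -
    let ?r = "m (6 - k - l)"
    note klr = third_index[OF kl(1-3)]
    have sum: "m k + m l + ?r = n - 1"
      using klr(4)[of m] m by (simp add: lattice_def)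
    have "m = corner_base n M k l ?r"
    proof
      fix p
      have "m p = 0" if "p \<notin> {k, l, 6 - k - l}"
        using m that unfolding klr(3) by (cases "p = 4") (auto simp: lattice_def)
      then show "m p = corner_base n M k l ?r p"
        using sum kl(4) klr(1,2) by (auto simp: corner_base_def)
    qed
    moreover have "(k, l, ?r) \<in> corner_index M"
      using sum kl by (auto simp: corner_index_def)
    ultimately show ?thesis by (force simp: corner_edge_def)
  qed
  have "m i + 1 + M = n \<or> m j + 1 + M = n"
  proof (rule ccontr)
    assume "\<not> ?thesis"
    then have eq: "n \<le> inc m i p + M \<longleftrightarrow> n \<le> inc m j p + M" for p
      by (auto simp: inc_def)
    have "inc m i 4 = inc m j 4" using ij m(2) by (auto simp: inc_def)
    then show False using neq by (simp add: corner_cut_def eq cong: if_cong)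
  qed
  then show ?thesis using key[of i j] key[of j i] ij edge_commute[of n m i j] by auto
qed

text \<open>Forgetting coordinate \<open>k\<close> is injective because the sum is fixed, and it
  maps the corner into the triangle of pairs with sum at most \<open>M\<close>.\<close>

lemma card_lattice_corner:
  assumes "k \<in> {1..3}"
  shows "finite {m \<in> lattice N. m 4 = 0 \<and> N \<le> m k + M}" (is "finite ?S")
    and "real (card {m \<in> lattice N. m 4 = 0 \<and> N \<le> m k + M}) \<le> (real M + 1) * (real M + 2) / 2"
proof -
  define D where "D = (SIGMA r : {..M}. {..M - r})"
  have "real (card D) = (\<Sum>r\<le>M. real (M - r) + 1)"
    by (simp add: D_def add.commute)
  also have "\<dots> = (\<Sum>r\<le>M. real r + 1)"
    using sum.atLeastAtMost_rev[of "\<lambda>r. real r + 1" 0 M] by (simp add: atMost_atLeast0)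
  also have "\<dots> = (real M + 1) * (real M + 2) / 2"
    by (induction M) (auto simp: field_simps)
  finally have card: "real (card D) = (real M + 1) * (real M + 2) / 2" .
  have fin: "finite D" by (simp add: D_def)
  obtain p q where pq: "{k, p, q} = {1, 2, 3}" "\<And>m :: nat \<Rightarrow> nat. m 1 + m 2 + m 3 = m k + m p + m q"
  proof -
    consider "k = 1" | "k = 2" | "k = 3" using assms by force
    then show thesis
    proof cases
      case 1 then show ?thesis using that[of 2 3] by simp
    next
      case 2 then show ?thesis using that[of 1 3] by (simp add: insert_commute)
    next
      case 3 then show ?thesis using that[of 1 2] by (simp add: insert_commute)
    qed
  qed
  have sum: "m k + m p + m q = N" if "m \<in> ?S" for m
    using that pq(2)[of m] by (simp add: lattice_def)
  have inj: "inj_on (\<lambda>m. (m p, m q)) ?S"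
  proof (rule inj_onI)
    fix a b assume ab: "a \<in> ?S" "b \<in> ?S" "(a p, a q) = (b p, b q)"
    then have "\<forall>l\<in>{k, p, q}. a l = b l" using sum[OF ab(1)] sum[OF ab(2)] by auto
    then show "a = b" using ab(1,2) unfolding pq(1) by (intro lattice_eqI[of a N b N]) auto
  qed
  have sub: "(\<lambda>m. (m p, m q)) ` ?S \<subseteq> D"
    using sum by (fastforce simp: D_def)
  show "finite ?S" using inj sub fin by (meson finite_imageD finite_subset)
  show "real (card ?S) \<le> (real M + 1) * (real M + 2) / 2"
    using card_inj_on_le[OF inj sub fin] card by linarith
qed

text \<open>The factor 6 counts the pairs of a corner \<open>k\<close> and a direction
  \<open>l\<close>; \<open>b\<close> bounds one row of parallel boundary edges.\<close>

lemma corner_cost_le: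
  assumes M: "2 * M < n" and w: "\<And>e. 0 \<le> w e" "\<And>e. w e \<noteq> 0 \<Longrightarrow> e \<in> edges 4 n \<Longrightarrow> e \<in> edges 3 n"
    and b: "\<And>k l. \<lbrakk>k \<in> {1..3}; l \<in> {1..3}; k \<noteq> l\<rbrakk> \<Longrightarrow> (\<Sum>r\<le>M. w (corner_edge n M (k, l, r))) \<le> b"
  shows "cut_cost n w (corner_cut n M \<circ> coords n) \<le> 6 * b"
proof -
  note sum = sum_corner_index[where f = "\<lambda>t. w (corner_edge n M t)", OF b]
  have "cut_cost n w (corner_cut n M \<circ> coords n) \<le> (\<Sum>t\<in>corner_index M. w (corner_edge n M t))"
  proof (rule cut_cost_le_cover)
    fix m i j
    assume m: "m \<in> lattice (n - 1)" and i: "i \<in> {1..4}" and j: "j \<in> {1..4}" and ij: "i < j"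
      and neq: "corner_cut n M (inc m i) \<noteq> corner_cut n M (inc m j)"
      and e: "edge n m i j \<in> edges 4 n" "w (edge n m i j) \<noteq> 0"
    have "edge n m i j \<in> edges 3 n" using w(2) e by blast
    then have face: "m 4 = 0" "i \<noteq> 4" "j \<noteq> 4" using edge_face[of n m i j] M by auto
    then have "i \<in> {1..3}" "j \<in> {1..3}" using i j by auto
    then show "edge n m i j \<in> corner_edge n M ` corner_index M"
      using corner_cover[OF M m face(1)] ij neq by blast
  qed (use M w sum(1) in auto)
  also have "\<dots> \<le> 6 * b" using sum(2) .
  finally show ?thesis .
qed

text \<open>For \<open>r \<ge> 1\<close> the endpoints together have all three face coordinates in
  their supports, while a side allows only two.\<close>

lemma corner_edge_not_side:
  assumes kl: "k \<in> {1..3}" "l \<in> {1..3}" "k \<noteq> l" and r: "r \<in> {1..M}" and M: "2 * M < n"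
  shows "corner_edge n M (k, l, r) \<notin> L n p q"
proof
  assume e: "corner_edge n M (k, l, r) \<in> L n p q"
  note klr = third_index[OF kl]
  let ?b = "corner_base n M k l r"
  have e': "edge n ?b k l \<in> L n p q" using e by (simp add: corner_edge_def)
  have "i \<in> {p, q}" if "?b i \<noteq> 0 \<or> i = k \<or> i = l" for i
    using edge_side[OF e', of i] that M by (cases "i \<in> {p, q}") auto
  moreover have "?b (6 - k - l) \<noteq> 0" using klr r by (auto simp: corner_base_def)
  ultimately have "k \<in> {p, q}" "6 - k - l \<in> {p, q}" "l \<in> {p, q}" by blast+
  then show False using klr(1,2) kl(3) by auto
qed

text \<open>The graded side costs make the total independent of \<open>M\<close>. A row has one side
  edge, of cost \<open>(n/3 - M) * \<rho> n\<close>, and \<open>M\<close> inner edges of cost at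
  most \<open>\<rho> n\<close>, so it costs at most n/3 times \<open>\<rho> n\<close>, which is
  1/5.\<close>

lemma corner_I1_cost:
  assumes n: "3 dvd n" and M: "M + 1 \<le> n div 3"
  shows "cut_cost n (I1 n) (corner_cut n M \<circ> coords n) \<le> 6 / 5"
proof -
  have n0: "n > 0" and M2: "2 * M < n" using M by auto
  have M3: "real M + 1 \<le> real n / 3"
  proof -
    have "3 * (M + 1) \<le> n" using M by auto
    then have "real (3 * (M + 1)) \<le> real n" by (simp only: of_nat_le_iff)
    then show ?thesis by simp
  qed
  have "cut_cost n (I1 n) (corner_cut n M \<circ> coords n) \<le> 6 * (real n / 3 * \<rho> n)"
  proof (rule corner_cost_le[OF M2])
    fix k l :: nat assume kl: "k \<in> {1..3}" "l \<in> {1..3}" "k \<noteq> l"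
    note klr = third_index[OF kl]
    let ?e = "\<lambda>r. corner_edge n M (k, l, r)"
    have inner: "I1 n (?e r) \<le> \<rho> n" if r: "r \<in> {1..M}" for r
    proof -
      have "\<not> side_edge n t (?e r)" for t
        using corner_edge_not_side[OF kl r M2] by (auto simp: side_edge_def)
      then show ?thesis using J_le_rho[of n "?e r"] by (auto simp: I1_def \<rho>_def)
    qed
    have outer: "I1 n (?e 0) \<le> (real n / 3 - real M) * \<rho> n"
    proof (cases "?e 0 \<in> edges 3 n")
      case True
      let ?b = "corner_base n M k l 0"
      have e: "?e 0 = {pt n (inc ?b k), pt n (inc ?b l)}" by (simp add: corner_edge_def edge_def)
      have sub: "?e 0 \<subseteq> grid 4 n" using True by (auto simp: edges_3_eq_face_edges grid_3_eq_face)
      have "?e 0 \<in> L n k l"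
        using True sub kl unfolding e edges_3_eq_face_edges
        by (auto simp: L_def V_def Support_def pt_def inc_def corner_base_def split: if_splits)
      \<comment> \<open>The inner end has coordinate 1 - M/n, so the index of the side edge is
        \<open>M + 1\<close>; this is why \<open>M + 1 \<le> n div 3\<close> is assumed.\<close>
      moreover have "pt n (inc ?b k) k = 1 - (real (M + 1) - 1) / real n"
        "pt n (inc ?b l) k = 1 - real (M + 1) / real n"
        using n0 M2 kl by (auto simp: pt_def inc_def corner_base_def field_simps of_nat_diff)
      ultimately have "side_edge n (M + 1) (?e 0)"
        unfolding side_edge_def using kl M e by fastforce
      then show ?thesis using J_side_edge[of n "M + 1" "?e 0"] True by (simp add: I1_def)
    next
      case False
      then show ?thesis using M3 by (simp add: I1_def \<rho>_def)
    qed
    have "(\<Sum>r\<le>M. I1 n (?e r)) = I1 n (?e 0) + (\<Sum>r\<in>{1..M}. I1 n (?e r))"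
      by (simp add: sum.atLeast_Suc_atMost atMost_atLeast0)
    also have "\<dots> \<le> (real n / 3 - real M) * \<rho> n + (\<Sum>r\<in>{1..M}. \<rho> n)"
      using outer inner by (intro add_mono sum_mono)
    also have "\<dots> = real n / 3 * \<rho> n" by (simp add: algebra_simps)
    finally show "(\<Sum>r\<le>M. I1 n (?e r)) \<le> real n / 3 * \<rho> n" .
  qed (auto simp: I1_def J_nonneg split: if_splits)
  also have "\<dots> = 6 / 5" using n0 by (simp add: \<rho>_def)
  finally show ?thesis .
qed

lemma L_subset_face:
  assumes "e \<in> L n i j" "i \<noteq> 4" "j \<noteq> 4"
  shows "e \<in> edges 3 n"
  using assms unfolding edges_3_eq_face_edges grid_3_eq_face L_def V_def Support_def by auto

text \<open>Only the edge with \<open>r = 0\<close> of each of the six rows lies on a side.\<close>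

lemma corner_I2_cost:
  assumes M: "2 * M < n"
  shows "cut_cost n (I2 n) (corner_cut n M \<circ> coords n) \<le> 2"
proof -
  have "cut_cost n (I2 n) (corner_cut n M \<circ> coords n) \<le> 6 * (1 / 3)"
  proof (rule corner_cost_le[OF M])
    fix k l :: nat assume kl: "k \<in> {1..3}" "l \<in> {1..3}" "k \<noteq> l"
    let ?e = "\<lambda>r. corner_edge n M (k, l, r)"
    have "I2 n (?e r) = 0" if "r \<in> {1..M}" for r
      using corner_edge_not_side[OF kl that M] by (simp add: I2_def)
    then have "(\<Sum>r\<in>{1..M}. I2 n (?e r)) = 0" by simp
    then have "(\<Sum>r\<le>M. I2 n (?e r)) = I2 n (?e 0)"
      by (simp add: sum.atLeast_Suc_atMost atMost_atLeast0)
    then show "(\<Sum>r\<le>M. I2 n (?e r)) \<le> 1 / 3" by (simp add: I2_def)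
  qed (auto simp: I2_def L_subset_face split: if_splits)
  then show ?thesis by simp
qed

text \<open>For \<open>M = 0\<close> each row is a single edge at a vertex, so at most six edges of
  weight 1/(9c) are paid.\<close>

lemma corner_I3_cost:
  assumes n: "n > 0" and c: "c > 0"
  shows "cut_cost n (I3 n c) (corner_cut n 0 \<circ> coords n) \<le> 2 / (3 * c)"
proof -
  have face: "e \<in> edges 3 n" if "I3 n c e \<noteq> 0" for e
  proof -
    have "\<exists>k\<in>{1..3}. e \<in> \<Gamma> n c k"
      using that unfolding atLeastAtMost_1_3 by (auto simp: I3_def split: if_splits)
    then obtain k where k: "k \<in> {1..3}" "e \<in> \<Gamma> n c k" by blast
    then have "e \<subseteq> grid 3 n" using R_face[of _ n c k] by (auto simp: \<Gamma>_def grid_3_eq_face)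
    then show ?thesis using k by (simp add: \<Gamma>_def edges_3_eq_face_edges)
  qed
  have "cut_cost n (I3 n c) (corner_cut n 0 \<circ> coords n) \<le> 6 * (1 / (9 * c))"
    by (rule corner_cost_le) (use n c face in \<open>auto simp: I3_def\<close>)
  also have "\<dots> = 2 / (3 * c)" using c by (simp add: field_simps)
  finally show ?thesis .
qed

text \<open>The quadratic term comes from the upward edges: three corners, three directions
  \<open>i\<close>, and a triangle of bases for each. The face edges contribute only linearly in
  \<open>M\<close>.\<close>

lemma corner_I4_cost:
  assumes n: "n \<ge> 2" and M: "2 * M < n"
  shows "cut_cost n (I4 n) (corner_cut n M \<circ> coords n)
    \<le> (6 * (real M + 1) + 9 * ((real M + 1) * (real M + 2) / 2) + 3) / (real n)\<^sup>2"
proof -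
  define S where "S = (\<lambda>k. {m \<in> lattice (n - 1). m 4 = 0 \<and> n - 1 \<le> m k + M})"
  define B where "B = (\<Union>k\<in>{1..3}. S k) \<times> {1..3::nat}"
  define A where "A = (\<lambda>(k, l, r). (corner_base n M k l r, k, l)) ` corner_index M"
  note idx = sum_corner_index[where f = "\<lambda>_. 1" and M = M and b = "real M + 1"]
  have finI: "finite (corner_index M)" by (rule idx) simp
  have "(\<Sum>t\<in>corner_index M. 1) \<le> 6 * (real M + 1)" by (rule idx) simp
  then have cardA: "real (card A) \<le> 6 * (real M + 1)"
    using card_image_le[OF finI, of "\<lambda>(k, l, r). (corner_base n M k l r, k, l)"]
    unfolding A_def by simp
  have S: "finite (S k)" "real (card (S k)) \<le> (real M + 1) * (real M + 2) / 2" if "k \<in> {1..3}" for k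
    using card_lattice_corner[OF that, of "n - 1" M] by (simp_all add: S_def)
  have "real (card (\<Union>k\<in>{1..3}. S k)) \<le> real (\<Sum>k\<in>{1..3}. card (S k))"
    by (intro of_nat_mono card_UN_le) simp
  also have "\<dots> \<le> (\<Sum>k\<in>{1..3::nat}. (real M + 1) * (real M + 2) / 2)"
    unfolding of_nat_sum by (intro sum_mono S)
  also have "\<dots> = 3 * ((real M + 1) * (real M + 2) / 2)" by simp
  finally have cardB: "real (card B) \<le> 9 * ((real M + 1) * (real M + 2) / 2)"
    by (simp add: B_def card_cartesian_product)
  have "cut_cost n (I4 n) (corner_cut n M \<circ> coords n) \<le> (real (card A) + real (card B) + 3) / (real n)\<^sup>2"
  proof (rule I4_cost_le[OF n face_labelling_corner_cut[OF M]])
    show "finite A" "finite B" using S finI by (auto simp: A_def B_def)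
    fix m and i :: nat
    assume m: "m \<in> lattice (n - 1)" "m 4 = 0" and i: "i \<in> {1..3}"
    { fix j assume "j \<in> {1..3}" "i < j" "corner_cut n M (inc m i) \<noteq> corner_cut n M (inc m j)"
      then have "edge n m i j \<in> corner_edge n M ` corner_index M"
        using corner_cover[OF M m i] by blast
      also have "corner_edge n M ` corner_index M = (\<lambda>(m, i, j). edge n m i j) ` A"
        by (simp add: A_def image_image corner_edge_def split_def)
      finally show "edge n m i j \<in> (\<lambda>(m, i, j). edge n m i j) ` A" . }
    assume five: "corner_cut n M (inc m i) \<noteq> 5"
    have "inc m i 4 = 0" using m i by (auto simp: inc_def)
    then have "\<exists>k\<in>{1, 2, 3}. n \<le> inc m i k + M"
      using five n by (auto simp: corner_cut_def split: if_splits)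
    then obtain k where k: "k \<in> {1..3}" "n \<le> inc m i k + M"
      unfolding atLeastAtMost_1_3 by blast
    then have "m \<in> S k" using m by (auto simp: S_def inc_def split: if_splits)
    then show "(m, i) \<in> B" using k i by (auto simp: B_def)
  qed
  also have "\<dots> \<le> (6 * (real M + 1) + 9 * ((real M + 1) * (real M + 2) / 2) + 3) / (real n)\<^sup>2"
    using cardA cardB by (intro divide_right_mono) auto
  finally show ?thesis .
qed

section \<open>The largest-coordinate cut and its costs\<close>

definition argmax_cut :: "nat \<Rightarrow> (nat \<Rightarrow> nat) \<Rightarrow> nat" where
  "argmax_cut n a = (if a 4 = n then 4 else if a 4 \<noteq> 0 then 5
     else if a 2 \<le> a 1 \<and> a 3 \<le> a 1 then 1 else if a 3 \<le> a 2 then 2 else 3)"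

text \<open>The tie-breaking rule is captured by comparing the distinct keys \<open>4 a\<^sub>i - i\<close>.\<close>

lemma argmax_cut_key:
  assumes "n > 0" "a 4 = 0"
  shows "argmax_cut n a \<in> {1..3}"
    and "j \<in> {1..3} \<Longrightarrow> j \<noteq> argmax_cut n a \<Longrightarrow>
      4 * int (a j) + int (argmax_cut n a) < 4 * int (a (argmax_cut n a)) + int j"
  using assms unfolding argmax_cut_def atLeastAtMost_1_3 by auto

lemma argmax_cut_majority:
  assumes "a \<in> lattice n" "a 4 = 0" "k \<in> {1..3}" "n < 2 * a k"
  shows "argmax_cut n a = k"
  using assms unfolding argmax_cut_def lattice_def atLeastAtMost_1_3 by auto

lemma face_labelling_argmax_cut:
  assumes "n > 0"
  shows "face_labelling n (argmax_cut n)"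
  using assms unfolding face_labelling_def atLeastAtMost_1_3 argmax_cut_def lattice_def by auto

text \<open>On the line of edges in direction \<open>i, j\<close> at height \<open>d\<close> of the third coordinate \<open>k\<close>, the labels
  change once, from \<open>i\<close> to \<open>j\<close>, if \<open>d\<close> is below \<open>n/3\<close>, and twice, with a run of \<open>k\<close> in between, if \<open>d\<close> is
  between \<open>n/3\<close> and \<open>n/2\<close>.\<close>

lemma card_argmax_direction:
  assumes n: "n = 3 * q" "q > 0" and i: "i \<in> {1..3}" and j: "j \<in> {1..3}" and neq: "i \<noteq> j"
  defines "D \<equiv> {m \<in> lattice (n - 1). m 4 = 0 \<and> argmax_cut n (inc m i) \<noteq> argmax_cut n (inc m j)}"
  shows "finite D" "card D \<le> q + 1 + 2 * (n div 2 + 1 - q)"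
proof -
  define k where "k = 6 - i - j"
  note ijk = third_index[OF i j neq, folded k_def]
  have k: "k \<in> {1..3}" using ijk(3) by auto
  define S where "S = (\<lambda>p s. {m \<in> lattice (n - 1). m 4 = 0 \<and>
    argmax_cut n (inc m i) = p \<and> argmax_cut n (inc m j) = s})"
  have base: "int (m i) + int (m j) + int (m k) = int n - 1"
    "argmax_cut n (inc m i) \<in> {i, j, k}" "argmax_cut n (inc m j) \<in> {i, j, k}"
    "\<And>l p. \<lbrakk>l \<in> {i, j, k}; l \<noteq> p; argmax_cut n (inc m i) = p\<rbrakk> \<Longrightarrow>
      4 * int (inc m i l) + int p < 4 * int (inc m i p) + int l"
    "\<And>l p. \<lbrakk>l \<in> {i, j, k}; l \<noteq> p; argmax_cut n (inc m j) = p\<rbrakk> \<Longrightarrow>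
      4 * int (inc m j l) + int p < 4 * int (inc m j p) + int l"
    if m: "m \<in> lattice (n - 1)" "m 4 = 0" for m
  proof -
    have "inc m i 4 = 0" "inc m j 4 = 0" using i j m(2) by (auto simp: inc_def)
    note keyi = argmax_cut_key[of n "inc m i", OF _ this(1)]
      and keyj = argmax_cut_key[of n "inc m j", OF _ this(2)]
    show "argmax_cut n (inc m i) \<in> {i, j, k}" "argmax_cut n (inc m j) \<in> {i, j, k}"
      using keyi(1) keyj(1) n unfolding ijk(3) by auto
    show "4 * int (inc m i l) + int p < 4 * int (inc m i p) + int l"
      if "l \<in> {i, j, k}" "l \<noteq> p" "argmax_cut n (inc m i) = p" for l p
      using keyi(2)[of l] that n unfolding ijk(3) by auto
    show "4 * int (inc m j l) + int p < 4 * int (inc m j p) + int l"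
      if "l \<in> {i, j, k}" "l \<noteq> p" "argmax_cut n (inc m j) = p" for l p
      using keyj(2)[of l] that n unfolding ijk(3) by auto
    show "int (m i) + int (m j) + int (m k) = int n - 1"
      using ijk(4)[of m] m n by (simp add: lattice_def)
  qed
  have rng: "1 \<le> int i" "int i \<le> 3" "1 \<le> int j" "int j \<le> 3" "1 \<le> int k" "int k \<le> 3"
    using i j k by auto
  have inc_eq: "inc m i i = m i + 1" "inc m i j = m j" "inc m i k = m k"
    "inc m j i = m i" "inc m j j = m j + 1" "inc m j k = m k" for m
    using neq ijk(1,2) by (auto simp: inc_def)
  have ij: "4 * int (m j) + int i < 4 * int (m i) + 4 + int j"
      "4 * int (m k) + int i < 4 * int (m i) + 4 + int k"
      "4 * int (m i) + int j < 4 * int (m j) + 4 + int i"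
      "4 * int (m k) + int j < 4 * int (m j) + 4 + int k" if "m \<in> S i j" for m
    using base(4)[of m j i] base(4)[of m k i] base(5)[of m i j] base(5)[of m k j] that neq ijk(1,2)
    by (auto simp: S_def inc_eq)
  have ik: "4 * int (m k) + int i < 4 * int (m i) + 4 + int k"
      "4 * int (m i) + int k < 4 * int (m k) + int i"
      "4 * int (m j) + 4 + int k < 4 * int (m k) + int j" if "m \<in> S i k" for m
    using base(4)[of m k i] base(5)[of m i k] base(5)[of m j k] that neq ijk(1,2)
    by (auto simp: S_def inc_eq)
  have kj: "4 * int (m k) + int j < 4 * int (m j) + 4 + int k"
      "4 * int (m j) + int k < 4 * int (m k) + int j"
      "4 * int (m i) + 4 + int k < 4 * int (m k) + int i" if "m \<in> S k j" for m
    using base(5)[of m k j] base(4)[of m j k] base(4)[of m i k] that neq ijk(1,2)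
    by (auto simp: S_def inc_eq)
  have sum: "int (m i) + int (m j) + int (m k) = int n - 1" if "m \<in> S p s" for m p s
    using base(1) that by (auto simp: S_def)
  \<comment> \<open>If \<open>j\<close> wins even after \<open>i\<close> is incremented, it also
    wins after \<open>j\<close> is incremented, and symmetrically for \<open>i\<close>. This leaves
    only three pairs of distinct labels.\<close>
  have D: "D \<subseteq> S i j \<union> S i k \<union> S k j"
  proof
    fix m assume "m \<in> D"
    then have m: "m \<in> lattice (n - 1)" "m 4 = 0"
      and ne: "argmax_cut n (inc m i) \<noteq> argmax_cut n (inc m j)" by (auto simp: D_def)
    have 1: "argmax_cut n (inc m i) \<noteq> j"
    proof
      assume a: "argmax_cut n (inc m i) = j"
      then have "4 * int (m i) + 4 + int j < 4 * int (m j) + int i"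
        "4 * int (m k) + int j < 4 * int (m j) + int k"
        using base(4)[OF m, of i j] base(4)[OF m, of k j] neq ijk(1,2) by (auto simp: inc_eq)
      moreover have "argmax_cut n (inc m j) = i \<or> argmax_cut n (inc m j) = k"
        using base(3)[OF m] a ne by auto
      ultimately show False
        using base(5)[OF m, of j i] base(5)[OF m, of j k] neq ijk(1,2) by (auto simp: inc_eq)
    qed
    have 2: "argmax_cut n (inc m j) \<noteq> i"
    proof
      assume a: "argmax_cut n (inc m j) = i"
      then have "4 * int (m j) + 4 + int i < 4 * int (m i) + int j"
        "4 * int (m k) + int i < 4 * int (m i) + int k"
        using base(5)[OF m, of j i] base(5)[OF m, of k i] neq ijk(1,2) by (auto simp: inc_eq)
      moreover have "argmax_cut n (inc m i) = j \<or> argmax_cut n (inc m i) = k"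
        using base(2)[OF m] a ne by auto
      ultimately show False
        using base(4)[OF m, of i j] base(4)[OF m, of i k] neq ijk(1,2) by (auto simp: inc_eq)
    qed
    show "m \<in> S i j \<union> S i k \<union> S k j"
      using base(2,3)[OF m] 1 2 ne m by (auto simp: S_def)
  qed
  \<comment> \<open>Fix \<open>m k\<close>. In the class \<open>(i, j)\<close> the keys leave two
    consecutive values for \<open>m i - m j\<close>, and the parity of the fixed sum
    \<open>m i + m j\<close> selects one. In the other classes an open interval of length 4 for the
    scaled key fixes \<open>m i\<close> or \<open>m j\<close>.\<close>
  have inj: "inj_on (\<lambda>m. m k) (S p s)" if ps: "(p, s) \<in> {(i, j), (i, k), (k, j)}" for p s
  proof (rule inj_onI)
    fix a b assume ab: "a \<in> S p s" "b \<in> S p s" "a k = b k"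
    have "a i = b i" using ps ab(3) sum[OF ab(1)] sum[OF ab(2)]
    proof (elim insertE emptyE)
      assume "(p, s) = (i, j)"
      then have "a \<in> S i j" "b \<in> S i j" using ab by auto
      then show ?thesis
        using ij[of a] ij[of b] ab(3) sum[OF ab(1)] sum[OF ab(2)] rng by linarith
    next
      assume "(p, s) = (i, k)"
      then have "a \<in> S i k" "b \<in> S i k" using ab by auto
      then show ?thesis
        using ik[of a] ik[of b] ab(3) sum[OF ab(1)] sum[OF ab(2)] rng by linarith
    next
      assume "(p, s) = (k, j)"
      then have "a \<in> S k j" "b \<in> S k j" using ab by auto
      then show ?thesis
        using kj[of a] kj[of b] ab(3) sum[OF ab(1)] sum[OF ab(2)] rng by linarith
    qed
    then have "\<forall>l\<in>{i, j, k}. a l = b l" using ab(3) sum[OF ab(1)] sum[OF ab(2)] by auto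
    then show "a = b" using ab(1,2) unfolding ijk(3) atLeastAtMost_1_3
      by (intro lattice_eqI[of a "n - 1" b "n - 1"]) (auto simp: S_def)
  qed
  \<comment> \<open>In this class \<open>k\<close> loses at both ends, so up to rounding
    \<open>m k\<close> is at most the average n/3. In the other two it wins at one end, giving at
    least n/3, and loses at the other, giving at most n/2.\<close>
  have im1: "(\<lambda>m. m k) ` S i j \<subseteq> {..q}"
  proof (intro image_subsetI, unfold atMost_iff)
    fix m assume m: "m \<in> S i j"
    show "m k \<le> q" using ij[OF m] sum[OF m] rng n(1) by linarith
  qed
  have im2: "(\<lambda>m. m k) ` S i k \<subseteq> {q..n div 2}"
  proof (intro image_subsetI, unfold atLeastAtMost_iff, intro conjI)
    fix m assume m: "m \<in> S i k"
    show "q \<le> m k" using ik[OF m] sum[OF m] rng n(1) by linarith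
    have "2 * m k \<le> n" using ik[OF m] sum[OF m] rng by linarith
    then show "m k \<le> n div 2" by simp
  qed
  have im3: "(\<lambda>m. m k) ` S k j \<subseteq> {q..n div 2}"
  proof (intro image_subsetI, unfold atLeastAtMost_iff, intro conjI)
    fix m assume m: "m \<in> S k j"
    show "q \<le> m k" using kj[OF m] sum[OF m] rng n(1) by linarith
    have "2 * m k \<le> n" using kj[OF m] sum[OF m] rng by linarith
    then show "m k \<le> n div 2" by simp
  qed
  have fin: "finite (S i j)" "finite (S i k)" "finite (S k j)"
    using inj im1 im2 im3 by (meson finite_imageD finite_subset finite_atMost finite_atLeastAtMost insertCI)+
  then show "finite D" using D by (meson finite_UnI finite_subset)
  have "card D \<le> card (S i j \<union> S i k \<union> S k j)" using D fin by (intro card_mono) auto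
  also have "\<dots> \<le> card (S i j) + card (S i k) + card (S k j)"
    using card_Un_le[of "S i j \<union> S i k" "S k j"] card_Un_le[of "S i j" "S i k"] by linarith
  also have "\<dots> \<le> card {..q} + card {q..n div 2} + card {q..n div 2}"
    using inj im1 im2 im3 by (intro add_mono card_inj_on_le[where f = "\<lambda>m. m k"]) auto
  finally show "card D \<le> q + 1 + 2 * (n div 2 + 1 - q)" by simp
qed

definition argmax_index :: "nat \<Rightarrow> ((nat \<Rightarrow> nat) \<times> nat \<times> nat) set" where
  "argmax_index n = {(m, i, j). m \<in> lattice (n - 1) \<and> m 4 = 0 \<and> i \<in> {1..3} \<and> j \<in> {1..3} \<and> i < j \<and>
     argmax_cut n (inc m i) \<noteq> argmax_cut n (inc m j)}"

text \<open>Each of the three directions contributes n/3 + 2(n/2 - n/3) = 2n/3 up to a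
  constant.\<close>

lemma card_argmax_index:
  assumes "n = 3 * q" "q > 0"
  shows "finite (argmax_index n)" "real (card (argmax_index n)) \<le> 2 * real n + 9"
proof -
  define D where "D = (\<lambda>(i, j). {m \<in> lattice (n - 1). m 4 = 0 \<and>
    argmax_cut n (inc m i) \<noteq> argmax_cut n (inc m j)})"
  define Q :: "(nat \<times> nat) set" where "Q = {(1, 2), (1, 3), (2, 3)}"
  define h where "h = (\<lambda>(p :: nat \<times> nat, m :: nat \<Rightarrow> nat). (m, fst p, snd p))"
  have fin: "finite (D p)" and card: "card (D p) \<le> q + 1 + 2 * (n div 2 + 1 - q)" if "p \<in> Q" for p
    using card_argmax_direction[OF assms, of "fst p" "snd p"] that
    by (auto simp: D_def Q_def split_def)
  have eq: "argmax_index n = h ` (Sigma Q D)"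
    unfolding argmax_index_def h_def D_def Q_def atLeastAtMost_1_3 by (force simp: image_iff)
  have finS: "finite (Sigma Q D)" using fin by (intro finite_SigmaI) (auto simp: Q_def)
  then show "finite (argmax_index n)" by (simp add: eq)
  have "card (argmax_index n) \<le> card (Sigma Q D)" unfolding eq using finS by (rule card_image_le)
  also have "\<dots> = (\<Sum>p\<in>Q. card (D p))" using fin by (intro card_SigmaI) (auto simp: Q_def)
  also have "\<dots> \<le> (\<Sum>p\<in>Q. q + 1 + 2 * (n div 2 + 1 - q))" using card by (intro sum_mono)
  also have "\<dots> = 3 * (q + 1 + 2 * (n div 2 + 1 - q))" by (simp add: Q_def)
  also have "\<dots> \<le> 2 * n + 9" using assms by presburger
  finally show "real (card (argmax_index n)) \<le> 2 * real n + 9" by linarith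
qed

text \<open>Both ends of a graded side edge have a coordinate at least 2/3, hence the same majority
  label. The cut therefore avoids these edges and pays at most \<open>\<rho> n\<close> per face
  edge.\<close>

lemma argmax_side_edge:
  assumes m: "m \<in> lattice (n - 1)" "m 4 = 0" and ij: "i \<in> {1..3}" "j \<in> {1..3}"
    and e: "side_edge n t (edge n m i j)"
  shows "argmax_cut n (inc m i) = argmax_cut n (inc m j)"
proof -
  obtain p x y where p: "p \<in> {1..3}" "t \<in> {1..n div 3}" "edge n m i j = {x, y}"
    "x p = 1 - (real t - 1) / real n" "y p = 1 - real t / real n"
    using e unfolding side_edge_def by blast
  have n: "n > 0" using p(2) by (cases n) auto
  have t: "3 * real t \<le> real n" using p(2) by auto
  have "real t / real n \<le> 1 / 3" "(real t - 1) / real n \<le> 1 / 3" using t n by (auto simp: field_simps)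
  then have "z p \<ge> 2 / 3" if "z \<in> {x, y}" for z
    using that p(4,5) by auto
  then have big: "z p \<ge> 2 / 3" if "z \<in> edge n m i j" for z using that p(3) by simp
  have "argmax_cut n (inc m l) = p" if l: "l \<in> {i, j}" for l
  proof (rule argmax_cut_majority)
    show "inc m l \<in> lattice n" using inc_lattice[OF m(1) n] l ij by auto
    show "inc m l 4 = 0" using l ij m(2) by (auto simp: inc_def)
    have "pt n (inc m l) p \<ge> 2 / 3" using l by (intro big) (auto simp: edge_def)
    then have "3 * real (inc m l p) \<ge> 2 * real n" using n by (simp add: pt_def field_simps)
    then show "n < 2 * inc m l p" using n by linarith
  qed (rule p(1))
  then show ?thesis by simp
qed

lemma argmax_I1_cost:
  assumes "n = 3 * q" "q > 0"
  shows "cut_cost n (I1 n) (argmax_cut n \<circ> coords n) \<le> 6 / 5 + 27 / (5 * real n)"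
proof -
  have n: "n > 0" using assms by simp
  let ?E = "\<lambda>(m, i, j). edge n m i j"
  note card = card_argmax_index[OF assms]
  have "cut_cost n (I1 n) (argmax_cut n \<circ> coords n) \<le> (\<Sum>t\<in>argmax_index n. I1 n (?E t))"
  proof (rule cut_cost_le_cover)
    fix m i j
    assume m: "m \<in> lattice (n - 1)" and i: "i \<in> {1..4}" and j: "j \<in> {1..4}" and ij: "i < j"
      and neq: "argmax_cut n (inc m i) \<noteq> argmax_cut n (inc m j)"
      and "I1 n (edge n m i j) \<noteq> 0"
    then have "edge n m i j \<in> edges 3 n" by (auto simp: I1_def split: if_splits)
    then have "(m, i, j) \<in> argmax_index n"
      using edge_face[of n m i j] n m i j ij neq by (auto simp: argmax_index_def)
    then show "edge n m i j \<in> ?E ` argmax_index n" by force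
  qed (use n card(1) in \<open>auto simp: I1_def J_nonneg\<close>)
  also have "\<dots> \<le> (\<Sum>t\<in>argmax_index n. \<rho> n)"
  proof (rule sum_mono)
    fix t assume t: "t \<in> argmax_index n"
    then have "\<not> side_edge n s (?E t)" for s
      using argmax_side_edge by (auto simp: argmax_index_def)
    then show "I1 n (?E t) \<le> \<rho> n" using J_le_rho[of n "?E t"] by (simp add: I1_def \<rho>_def)
  qed
  also have "\<dots> \<le> (2 * real n + 9) * \<rho> n"
    unfolding sum_constant using card(2) by (intro mult_right_mono) (simp_all add: \<rho>_def)
  also have "\<dots> = 6 / 5 + 27 / (5 * real n)" using n by (simp add: \<rho>_def field_simps)
  finally show ?thesis .
qed

lemma argmax_I2_cost:
  assumes n: "n > 0"
  shows "cut_cost n (I2 n) (argmax_cut n \<circ> coords n) \<le> 1"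
proof -
  \<comment> \<open>The base of the midpoint edge of a side, the only edge cut there. Ties favour
    the smaller index \<open>p\<close>, so for even \<open>n\<close> the larger half sits at
    \<open>q\<close>.\<close>
  define h where "h = (\<lambda>(p :: nat, q :: nat) l :: nat. if l = p then (n - 1) div 2 else if l = q then n div 2 else 0)"
  define E where "E = (\<lambda>(p, q). edge n (h (p, q)) p q)"
  define Q :: "(nat \<times> nat) set" where "Q = {(1, 2), (1, 3), (2, 3)}"
  have "cut_cost n (I2 n) (argmax_cut n \<circ> coords n) \<le> (\<Sum>t\<in>Q. I2 n (E t))"
  proof (rule cut_cost_le_cover)
    fix m i j
    assume m: "m \<in> lattice (n - 1)" and i: "i \<in> {1..4}" and j: "j \<in> {1..4}" and ij: "i < j"
      and neq: "argmax_cut n (inc m i) \<noteq> argmax_cut n (inc m j)"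
      and e: "I2 n (edge n m i j) \<noteq> 0"
    obtain p q where pq: "(p, q) \<in> Q" "edge n m i j \<in> L n p q"
      using e by (auto simp: I2_def Q_def split: if_splits)
    note side = edge_side[OF pq(2) n]
    have "i \<in> {p, q}" "j \<in> {p, q}" using side(2)[of i] side(3)[of j] by blast+
    then have eq: "i = p" "j = q" using ij pq(1) by (auto simp: Q_def)
    have z: "m l = 0" if "l \<notin> {p, q}" for l using side(1) that .
    have s: "m p + m q = n - 1"
      using m pq(1) z[of 1] z[of 2] z[of 3] z[of 4] by (auto simp: Q_def lattice_def)
    have "m p \<le> m q" "m q \<le> m p + 1"
      using neq n pq(1) s z[of 1] z[of 2] z[of 3] z[of 4] unfolding eq
      by (auto simp: Q_def argmax_cut_def inc_def split: if_splits)
    then have "m p = (n - 1) div 2" "m q = n div 2" using s n by linarith+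
    then have "m = h (p, q)" using z by (auto simp: h_def)
    then show "edge n m i j \<in> E ` Q" using pq(1) eq by (force simp: E_def)
  qed (use n in \<open>auto simp: I2_def Q_def\<close>)
  also have "\<dots> \<le> (\<Sum>t\<in>Q. 1 / 3)" by (intro sum_mono) (simp add: I2_def)
  also have "\<dots> = 1" by (simp add: Q_def)
  finally show ?thesis .
qed

text \<open>No face point is labelled 5, so every base on the face contributes three upward edges;
  there are n(n+1)/2 bases.\<close>

lemma argmax_I4_cost:
  assumes "n = 3 * q" "q > 0"
  shows "cut_cost n (I4 n) (argmax_cut n \<circ> coords n)
    \<le> (2 * real n + 9 + 3 * (real n * (real n + 1) / 2) + 3) / (real n)\<^sup>2"
proof -
  \<comment> \<open>A corner of size \<open>n - 1\<close> is the whole face, so the corner count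
    applies.\<close>
  define S where "S = {m \<in> lattice (n - 1). m 4 = 0 \<and> n - 1 \<le> m 1 + (n - 1)}"
  have "real (n - 1) + 1 = real n" "real (n - 1) + 2 = real n + 1" using assms by auto
  note n1 = this
  note corner = card_lattice_corner[of 1 "n - 1" "n - 1", folded S_def, unfolded n1]
  have S: "finite S" "real (card S) \<le> real n * (real n + 1) / 2" by (rule corner; simp)+
  note A = card_argmax_index[OF assms]
  have "cut_cost n (I4 n) (argmax_cut n \<circ> coords n)
    \<le> (real (card (argmax_index n)) + real (card (S \<times> {1..3::nat})) + 3) / (real n)\<^sup>2"
    by (rule I4_cost_le)
      (use assms S A face_labelling_argmax_cut[of n] in \<open>force simp: argmax_index_def S_def\<close>)+
  also have "\<dots> \<le> (2 * real n + 9 + 3 * (real n * (real n + 1) / 2) + 3) / (real n)\<^sup>2"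
    using A(2) S(2) by (intro divide_right_mono) (auto simp: card_cartesian_product)
  finally show ?thesis .
qed

section \<open>Error terms and averaging over the cuts\<close>

lemma corner_I4_cost_asymp:
  assumes n: "n \<ge> 2" and M: "2 * M < n"
  shows "cut_cost n (I4 n) (corner_cut n M \<circ> coords n) \<le> 9/2 * (real M / real n)\<^sup>2 + 40 / real n"
proof -
  have "(6 * (real M + 1) + 9 * ((real M + 1) * (real M + 2) / 2) + 3)
      = 9/2 * (real M)\<^sup>2 + (39/2 * real M + 18)"
    by (simp add: field_simps power2_eq_square)
  \<comment> \<open>The constant 40 is generous; it is shared by all error terms.\<close>
  also have "\<dots> \<le> 9/2 * (real M)\<^sup>2 + 40 * real n"
    using M n by simp
  finally have "cut_cost n (I4 n) (corner_cut n M \<circ> coords n) \<le> (9/2 * (real M)\<^sup>2 + 40 * real n) / (real n)\<^sup>2"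
    using corner_I4_cost[OF n M] by (meson divide_right_mono order_trans zero_le_power2)
  also have "\<dots> = 9/2 * (real M / real n)\<^sup>2 + 40 / real n"
    using n by (simp add: power2_eq_square field_simps)
  finally show ?thesis .
qed

lemma argmax_I4_cost_asymp:
  assumes "n = 3 * q" "q > 0"
  shows "cut_cost n (I4 n) (argmax_cut n \<circ> coords n) \<le> 3/2 + 40 / real n"
proof -
  have n: "real n \<ge> 1" using assms by simp
  have "2 * real n + 9 + 3 * (real n * (real n + 1) / 2) + 3 = 3/2 * (real n)\<^sup>2 + (7/2 * real n + 12)"
    by (simp add: field_simps power2_eq_square)
  also have "\<dots> \<le> 3/2 * (real n)\<^sup>2 + 40 * real n" using n by simp
  finally have "cut_cost n (I4 n) (argmax_cut n \<circ> coords n) \<le> (3/2 * (real n)\<^sup>2 + 40 * real n) / (real n)\<^sup>2"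
    using argmax_I4_cost[OF assms] by (meson divide_right_mono order_trans zero_le_power2)
  also have "\<dots> = 3/2 + 40 / real n" using n by (simp add: power2_eq_square field_simps)
  finally show ?thesis .
qed

lemma cut_cost_combination:
  "cut_cost n (\<lambda>e. l1 * I1 n e + l2 * I2 n e + l3 * I3 n c e + l4 * I4 n e) P
    = l1 * cut_cost n (I1 n) P + l2 * cut_cost n (I2 n) P + l3 * cut_cost n (I3 n c) P
      + l4 * cut_cost n (I4 n) P"
  by (simp add: cut_cost_def sum.distrib sum_distrib_left)

text \<open>The maximum over \<open>c > 0\<close> is attained near \<open>c = 0.0743\<close>, so the proof expands around this point.\<close>

lemma corner_weight_bound:
  fixes c :: real
  assumes "0 < c"
  shows "(20067/100000 - 360201/200000 * c) * (9/2 * c\<^sup>2) \<le> 67/40000"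
proof -
  \<comment> \<open>With p = 743/10000, the factor c + p/2 is chosen to cancel the linear term of
    the product.\<close>
  have "(c - 743/10000)\<^sup>2 * (c + 743/20000) = c ^ 3 - 2229/20000 * c\<^sup>2 + 410172407/2000000000000"
    by (simp add: power2_eq_square power3_eq_cube field_simps)
  moreover have "0 \<le> (c - 743/10000)\<^sup>2 * (c + 743/20000)" using assms by simp
  ultimately have "2229/20000 * c\<^sup>2 - 410172407/2000000000000 \<le> c ^ 3" by linarith
  moreover have "0 \<le> c\<^sup>2" by simp
  moreover have "(20067/100000 - 360201/200000 * c) * (9/2 * c\<^sup>2) = 9/2 * (20067/100000) * c\<^sup>2 - 9/2 * (360201/200000) * c ^ 3"
    by (simp add: power2_eq_square power3_eq_cube algebra_simps)
  ultimately show ?thesis by linarith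
qed

lemma convex_combination_le_cases:
  fixes B :: real
  assumes "y \<ge> 0" "a \<ge> 0" "b \<ge> 0" "y + a + b = 1" "y * p + a * q + b * r \<le> B"
  shows "p \<le> B \<or> q \<le> B \<or> r \<le> B"
proof (rule ccontr)
  assume "\<not> ?thesis"
  then have gt: "p > B" "q > B" "r > B" by auto
  then have "y * B \<le> y * p" "a * B \<le> a * q" "b * B \<le> b * r"
    using assms by (auto intro: mult_left_mono)
  moreover have "y * B + a * B + b * B = B" using assms(4) by (simp flip: distrib_right)
  moreover have "y > 0 \<or> a > 0 \<or> b > 0" using assms by linarith
  then have "y * B < y * p \<or> a * B < a * q \<or> b * B < b * r" using gt by auto
  ultimately show False using assms(5) by linarith
qed

theorem theorem4:
  fixes c :: real
  assumes "0 < c" and "c < 1/2"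
  shows "\<exists>err::nat \<Rightarrow> real. err \<in> O(\<lambda>n. 1 / real n) \<and>
    (\<forall>l1 l2 l3 l4 :: real. \<forall>n::nat.
       l1 \<ge> 0 \<and> l2 \<ge> 0 \<and> l3 \<ge> 0 \<and> l4 \<ge> 0 \<and> l1 + l2 + l3 + l4 = 1 \<and>
       n > 0 \<and> 3 dvd n \<and> c * real n \<in> \<int> \<longrightarrow>
       (\<exists>P. is_cut n P \<and> non_opposite n P \<and>
            cut_cost n (\<lambda>e. l1 * I1 n e + l2 * I2 n e + l3 * I3 n c e + l4 * I4 n e) P
              \<le> 1.20067 + err n))"
proof (intro exI[of _ "\<lambda>n. 40 / real n"] conjI allI impI)
  show "(\<lambda>n. 40 / real n) \<in> O(\<lambda>n. 1 / real n)"
    by (intro bigoI[of _ 40]) simp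
next
  fix l1 l2 l3 l4 :: real and n :: nat
  assume "l1 \<ge> 0 \<and> l2 \<ge> 0 \<and> l3 \<ge> 0 \<and> l4 \<ge> 0 \<and> l1 + l2 + l3 + l4 = 1 \<and> n > 0 \<and> 3 dvd n \<and> c * real n \<in> \<int>"
  then have l: "l1 \<ge> 0" "l2 \<ge> 0" "l3 \<ge> 0" "l4 \<ge> 0" "l1 + l2 + l3 + l4 = 1"
    and n: "n > 0" "3 dvd n" and cn: "c * real n \<in> \<int>" by auto
  obtain q where q: "n = 3 * q" "q > 0" using n by auto
  have n2: "n \<ge> 2" and n3: "0 + 1 \<le> n div 3" "2 * 0 < n" using q by auto
  define e where "e = 40 / real n"
  have e: "e \<ge> 0" by (simp add: e_def)
  define cost where "cost = cut_cost n (\<lambda>e. l1 * I1 n e + l2 * I2 n e + l3 * I3 n c e + l4 * I4 n e)"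
  \<comment> \<open>Errors occur only in the first and last costs; as
    \<open>l1 + l4 \<le> 1\<close>, they merge into a single \<open>e\<close>.\<close>
  have comb: "cost P \<le> l1 * b1 + l2 * b2 + l3 * b3 + l4 * b4 + e"
    if "cut_cost n (I1 n) P \<le> b1 + e" "cut_cost n (I2 n) P \<le> b2"
      "cut_cost n (I3 n c) P \<le> b3" "cut_cost n (I4 n) P \<le> b4 + e" for P b1 b2 b3 b4
  proof -
    have "cost P \<le> l1 * (b1 + e) + l2 * b2 + l3 * b3 + l4 * (b4 + e)"
      unfolding cost_def cut_cost_combination using that l by (intro add_mono mult_left_mono)
    also have "\<dots> = l1 * b1 + l2 * b2 + l3 * b3 + l4 * b4 + (l1 + l4) * e"
      by (simp add: algebra_simps)
    also have "\<dots> \<le> l1 * b1 + l2 * b2 + l3 * b3 + l4 * b4 + e"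
      using l e mult_right_mono[of "l1 + l4" 1 e] by simp
    finally show ?thesis .
  qed
  define PY PA where "PY = argmax_cut n \<circ> coords n" and "PA = (\<lambda>M. corner_cut n M \<circ> coords n)"
  have PY: "is_cut n PY \<and> non_opposite n PY"
    unfolding PY_def using face_labelling_cut[OF n(1) face_labelling_argmax_cut[OF n(1)]] by blast
  have PA: "is_cut n (PA M) \<and> non_opposite n (PA M)" if "2 * M < n" for M
    unfolding PA_def using face_labelling_cut[OF n(1) face_labelling_corner_cut[OF that]] by blast
  have costY: "cost PY \<le> l1 * (6/5) + l2 * 1 + l3 * 0 + l4 * (3/2) + e"
  proof (rule comb)
    have "27 / (5 * real n) \<le> e" using n(1) by (simp add: e_def field_simps)
    then show "cut_cost n (I1 n) PY \<le> 6/5 + e" using argmax_I1_cost[OF q] by (simp add: PY_def)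
    show "cut_cost n (I3 n c) PY \<le> 0" unfolding PY_def
    proof (rule I3_cost_eq_0[OF n(1) assms(1)])
      fix a k assume a: "a \<in> lattice n" "a 4 = 0" "k \<in> {1..3}" "real (a k) \<ge> (1 - c) * real n"
      \<comment> \<open>Here \<open>c < 1/2\<close> makes coordinate \<open>k\<close> a strict
        majority.\<close>
      have "1/2 * real n < (1 - c) * real n" using n(1) assms(2) by (intro mult_strict_right_mono) auto
      then have "n < 2 * a k" using a(4) by linarith
      then show "argmax_cut n a = k" using argmax_cut_majority a by blast
    qed
  qed (use argmax_I2_cost[OF n(1)] argmax_I4_cost_asymp[OF q] in \<open>simp_all add: PY_def e_def\<close>)
  have cost0: "cost (PA 0) \<le> l1 * (6/5) + l2 * 2 + l3 * (2 / (3 * c)) + l4 * 0 + e"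
  proof (rule comb)
    show "cut_cost n (I4 n) (PA 0) \<le> 0 + e"
      using corner_I4_cost_asymp[OF n2 n3(2)] by (simp add: PA_def e_def)
  qed (use corner_I1_cost[OF n(2) n3(1)] corner_I2_cost[OF n3(2)]
      corner_I3_cost[OF n(1) assms(1)] e in \<open>simp_all add: PA_def\<close>)
  have "\<exists>P. is_cut n P \<and> non_opposite n P \<and> cost P \<le> 120067/100000 + e"
  proof (cases "c < 1/9")
    case False
    have "2 / (3 * c) \<le> 6" using False by (simp add: field_simps)
    then have "l3 * (2 / (3 * c)) \<le> l3 * 6" using l by (intro mult_left_mono)
    \<comment> \<open>The term with weight 0 pads the average of two cuts to the three-cut form of
      \<open>convex_combination_le_cases\<close>.\<close>
    then have "4/5 * cost PY + 1/5 * cost (PA 0) + 0 * cost PY \<le> 120067/100000 + e"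
      using costY cost0 l by argo
    then have "cost PY \<le> 120067/100000 + e \<or> cost (PA 0) \<le> 120067/100000 + e \<or> cost PY \<le> 120067/100000 + e"
      using convex_combination_le_cases[of "4/5" "1/5" 0 "cost PY" "cost (PA 0)" "cost PY"] by simp
    then show ?thesis using PY PA[OF n3(2)] by blast
  next
    case c: True
    obtain z where z: "c * real n = of_int z" using cn by (auto elim: Ints_cases)
    define M where "M = nat z"
    have "0 \<le> c * real n" using assms(1) by simp
    then have M: "real M = c * real n" using z by (simp add: M_def)
    have "real M < 1/9 * real n" unfolding M using c n(1) by (intro mult_strict_right_mono) auto
    then have "9 * M < 9 * q \<and> 3 * M < q" using q by linarith
    then have M2: "2 * M < n" "M + 1 \<le> n div 3" using q by auto
    have costM: "cost (PA M) \<le> l1 * (6/5) + l2 * 2 + l3 * 0 + l4 * (9/2 * c\<^sup>2) + e"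
    proof (rule comb)
      show "cut_cost n (I3 n c) (PA M) \<le> 0" unfolding PA_def
      proof (rule I3_cost_eq_0[OF n(1) assms(1)])
        fix a k assume a: "a \<in> lattice n" "a 4 = 0" "k \<in> {1..3}" "real (a k) \<ge> (1 - c) * real n"
        then have "real n \<le> real (a k) + real M" unfolding M by (simp add: algebra_simps)
        then have "n \<le> a k + M" by linarith
        then show "corner_cut n M a = k" using corner_cut_eq a M2 by blast
      qed
      have "real M / real n = c" using M n(1) by simp
      then show "cut_cost n (I4 n) (PA M) \<le> 9/2 * c\<^sup>2 + e"
        using corner_I4_cost_asymp[OF n2 M2(1)] by (simp add: PA_def e_def)
    qed (use corner_I1_cost[OF n(2) M2(2)] corner_I2_cost[OF M2(1)] e in \<open>simp_all add: PA_def\<close>)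
    \<comment> \<open>The weight 79933/100000 of \<open>PY\<close> is 2 - 1.20067, which makes the
      average cost in \<open>I2\<close> exactly 1.20067. The factor in \<open>a\<close> is 3/2 times
      1.20067, chosen for \<open>I3\<close>.\<close>
    define a where "a = 360201/200000 * c"
    define b where "b = 20067/100000 - a"
    \<comment> \<open>The bound \<open>c < 1/9\<close> keeps \<open>b\<close> nonnegative, since
      1.801005/9 is below 0.20067.\<close>
    have ab: "a \<ge> 0" "b \<ge> 0" "79933/100000 + a + b = 1" using assms(1) c by (simp_all add: a_def b_def)
    have "79933/100000 * cost PY + a * cost (PA 0) + b * cost (PA M)
      \<le> 79933/100000 * (l1 * (6/5) + l2 * 1 + l3 * 0 + l4 * (3/2) + e)
        + a * (l1 * (6/5) + l2 * 2 + l3 * (2 / (3 * c)) + l4 * 0 + e)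
        + b * (l1 * (6/5) + l2 * 2 + l3 * 0 + l4 * (9/2 * c\<^sup>2) + e)"
      using costY cost0 costM ab by (intro add_mono mult_left_mono) auto
    also have "\<dots> = (79933/100000 + a + b) * (l1 * (6/5) + e) + (79933/100000 + 2 * (a + b)) * l2
        + a * (2 / (3 * c)) * l3 + (239799/200000 + b * (9/2 * c\<^sup>2)) * l4"
      by (simp add: algebra_simps)
    also have "\<dots> = (6/5 * l1 + e) + 120067/100000 * l2 + 120067/100000 * l3 + (239799/200000 + b * (9/2 * c\<^sup>2)) * l4"
    proof -
      have "a * (2 / (3 * c)) = 120067/100000" using assms(1) by (simp add: a_def)
      moreover have "79933/100000 + 2 * (a + b) = 120067/100000" by (simp add: b_def)
      ultimately show ?thesis by (simp only: ab(3) mult_1_left mult.commute[of l1])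
    qed
    also have "\<dots> \<le> (6/5 * l1 + e) + 120067/100000 * l2 + 120067/100000 * l3 + 120067/100000 * l4"
      \<comment> \<open>For \<open>I4\<close>, \<open>PY\<close> contributes 239799/200000, leaving
        exactly 67/40000 below 1.20067.\<close>
      using corner_weight_bound[OF assms(1)] l
      by (intro add_left_mono mult_right_mono) (simp_all add: a_def b_def)
    also have "\<dots> \<le> 120067/100000 + e" using l by argo
    finally have "cost PY \<le> 120067/100000 + e \<or> cost (PA 0) \<le> 120067/100000 + e \<or> cost (PA M) \<le> 120067/100000 + e"
      by (intro convex_combination_le_cases[OF _ ab]) auto
    then show ?thesis using PY PA[OF n3(2)] PA[OF M2(1)] by blast
  qed
  then show "\<exists>P. is_cut n P \<and> non_opposite n P \<and>
      cut_cost n (\<lambda>e. l1 * I1 n e + l2 * I2 n e + l3 * I3 n c e + l4 * I4 n e) P \<le> 1.20067 + 40 / real n"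
    by (simp add: cost_def e_def)
qed

end
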